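(* For every integer $d\ge 5$ there exist infinitely many (pairwise non-isomorphic) graphs that are generically partially rigid in $\mathbb{R}^d$.
   Context: All graphs are finite and simple. A realization of a graph $G=(V,E)$ with $v$ vertices in $\mathbb{R}^d$ is $p=(p_1,\dots,p_v)\in\mathbb{R}^{vd}$, where $p_i\in\mathbb{R}^d$ is the location of the $i$-th vertex; it defines the framework $G(p)$. Put $f_G(p)=\frac12(\ldots,|p_i-p_j|^2,\ldots)_{\{i,j\}\in E}\in\mathbb{R}^{E}$. A realization is generic if its coordinates are algebraically independent over $\mathbb{Q}$. A flexing of $G(p)$ is a differentiable one-parameter family of realizations including $p$ such that $f_G(q)=f_G(p)$ for all $q$ in the family; $G(p)$ is locally rigid if all its flexings are trivial (come from Euclidean motions). $G(p)$ is globally rigid if for every realization $q$ in $\mathbb{R}^d$, $f_G(p)=f_G(q)$ implies $|p_i-p_j|=|q_i-q_j|$ for all pairs of vertices $i,j$. An edge of a framework is redundant if removing it leaves a locally rigid framework; a framework is redundantly rigid if all of its edges are redundant. These properties do not depend on which generic realization is chosen; $G$ is called generically locally rigid, generically redundantly rigid, or generically globally rigid in $\mathbb{R}^d$ if its generic frameworks in $\mathbb{R}^d$ are respectively locally, redundantly, or globally rigid. A graph is $(d+1)$-connected if it has at least $d+2$ vertices and removing any at most $d$ vertices leaves a connected graph. A graph is generically partially rigid in $\mathbb{R}^d$ if it is $(d+1)$-connected and generically redundantly rigid in $\mathbb{R}^d$ but not generically globally rigid in $\mathbb{R}^d$. *)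

theory Defs
  imports "HOL-Analysis.Analysis" "HOL-Library.Poly_Mapping"
begin

section \<open>Graphs\<close>

type_synonym 'a graph = "'a set \<times> 'a set set"

abbreviation verts :: "'a graph \<Rightarrow> 'a set" where "verts G \<equiv> fst G"
abbreviation edges :: "'a graph \<Rightarrow> 'a set set" where "edges G \<equiv> snd G"

definition finite_simple_graph :: "'a graph \<Rightarrow> bool" where
  "finite_simple_graph G \<longleftrightarrow>
     finite (verts G) \<and> (\<forall>e\<in>edges G. e \<subseteq> verts G \<and> card e = 2)"

definition graph_iso :: "'a graph \<Rightarrow> 'b graph \<Rightarrow> bool" where
  "graph_iso G H \<longleftrightarrow>
     (\<exists>\<phi>. bij_betw \<phi> (verts G) (verts H) \<and>
        (\<forall>i\<in>verts G. \<forall>j\<in>verts G. {i, j} \<in> edges G \<longleftrightarrow> {\<phi> i, \<phi> j} \<in> edges H))"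

definition delete_edge :: "'a graph \<Rightarrow> 'a set \<Rightarrow> 'a graph" where
  "delete_edge G e = (verts G, edges G - {e})"

definition delete_verts :: "'a graph \<Rightarrow> 'a set \<Rightarrow> 'a graph" where
  "delete_verts G S = (verts G - S, {e \<in> edges G. e \<inter> S = {}})"

definition connected_graph :: "'a graph \<Rightarrow> bool" where
  "connected_graph G \<longleftrightarrow>
     verts G \<noteq> {} \<and>
     (\<forall>u\<in>verts G. \<forall>v\<in>verts G. (u, v) \<in> {(x, y). {x, y} \<in> edges G}\<^sup>*)"

definition vertex_connected :: "nat \<Rightarrow> 'a graph \<Rightarrow> bool" where
  "vertex_connected k G \<longleftrightarrow>
     card (verts G) \<ge> k + 1 \<and>
     (\<forall>S. S \<subseteq> verts G \<and> card S < k \<longrightarrow> connected_graph (delete_verts G S))"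

section \<open>Algebraic independence and generic realizations\<close>

text \<open>
  A polynomial over the rationals in variables of type \<open>'i\<close> is a finitely supported map from
  monomials (finitely supported exponent functions) to coefficients.
\<close>

type_synonym 'i rat_mpoly = "('i \<Rightarrow>\<^sub>0 nat) \<Rightarrow>\<^sub>0 rat"

definition mpoly_eval :: "('i \<Rightarrow> real) \<Rightarrow> 'i rat_mpoly \<Rightarrow> real" where
  "mpoly_eval x P =
     (\<Sum>m\<in>Poly_Mapping.keys P. of_rat (Poly_Mapping.lookup P m) *
        (\<Prod>i\<in>Poly_Mapping.keys m. x i ^ Poly_Mapping.lookup m i))"

definition alg_independent_over_rat :: "'i set \<Rightarrow> ('i \<Rightarrow> real) \<Rightarrow> bool" where
  "alg_independent_over_rat I x \<longleftrightarrow>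
     (\<forall>P :: 'i rat_mpoly.
        (\<forall>m\<in>Poly_Mapping.keys P. Poly_Mapping.keys m \<subseteq> I) \<and> mpoly_eval x P = 0 \<longrightarrow> P = 0)"

text \<open>
  A realization of \<open>G\<close> in \<open>\<real>\<^sup>d\<close>, \<open>d = CARD('n)\<close>, is a map \<open>p :: 'a \<Rightarrow> real ^ 'n\<close> of which only the
  values on \<open>verts G\<close> matter: no definition below depends on the values elsewhere.
\<close>

definition generic :: "'a graph \<Rightarrow> ('a \<Rightarrow> real ^ 'n) \<Rightarrow> bool" where
  "generic G p \<longleftrightarrow> alg_independent_over_rat (verts G \<times> UNIV) (\<lambda>(i, k). p i $ k)"

section \<open>Rigidity of frameworks\<close>

text \<open>
  The coordinate of an edge \<open>{i, j}\<close> is recorded at both \<open>(i, j)\<close> and \<open>(j, i)\<close>; pairs that are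
  not edges carry the dummy value \<open>0\<close>.
\<close>

definition edge_map :: "'a graph \<Rightarrow> ('a \<Rightarrow> real ^ 'n) \<Rightarrow> 'a \<times> 'a \<Rightarrow> real" where
  "edge_map G p = (\<lambda>(i, j). if {i, j} \<in> edges G then (norm (p i - p j))\<^sup>2 / 2 else 0)"

definition euclidean_motion :: "(real ^ 'n \<Rightarrow> real ^ 'n) \<Rightarrow> bool" where
  "euclidean_motion T \<longleftrightarrow> (\<exists>a f. orthogonal_transformation f \<and> T = (\<lambda>x. a + f x))"

definition flexing ::
  "'a graph \<Rightarrow> ('a \<Rightarrow> real ^ 'n) \<Rightarrow> real set \<Rightarrow> (real \<Rightarrow> 'a \<Rightarrow> real ^ 'n) \<Rightarrow> bool" where
  "flexing G p I q \<longleftrightarrow>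
     is_interval I \<and>
     (\<forall>i\<in>verts G. (\<lambda>t. q t i) differentiable_on I) \<and>
     (\<exists>t\<^sub>0\<in>I. \<forall>i\<in>verts G. q t\<^sub>0 i = p i) \<and>
     (\<forall>t\<in>I. edge_map G (q t) = edge_map G p)"

definition trivial_flexing ::
  "'a graph \<Rightarrow> ('a \<Rightarrow> real ^ 'n) \<Rightarrow> real set \<Rightarrow> (real \<Rightarrow> 'a \<Rightarrow> real ^ 'n) \<Rightarrow> bool" where
  "trivial_flexing G p I q \<longleftrightarrow>
     (\<forall>t\<in>I. \<exists>T. euclidean_motion T \<and> (\<forall>i\<in>verts G. q t i = T (p i)))"

definition locally_rigid :: "'a graph \<Rightarrow> ('a \<Rightarrow> real ^ 'n) \<Rightarrow> bool" where
  "locally_rigid G p \<longleftrightarrow> (\<forall>I q. flexing G p I q \<longrightarrow> trivial_flexing G p I q)"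

definition redundantly_rigid :: "'a graph \<Rightarrow> ('a \<Rightarrow> real ^ 'n) \<Rightarrow> bool" where
  "redundantly_rigid G p \<longleftrightarrow> (\<forall>e\<in>edges G. locally_rigid (delete_edge G e) p)"

definition globally_rigid :: "'a graph \<Rightarrow> ('a \<Rightarrow> real ^ 'n) \<Rightarrow> bool" where
  "globally_rigid G p \<longleftrightarrow>
     (\<forall>q :: 'a \<Rightarrow> real ^ 'n. edge_map G p = edge_map G q \<longrightarrow>
        (\<forall>i\<in>verts G. \<forall>j\<in>verts G. norm (p i - p j) = norm (q i - q j)))"

section \<open>Generic rigidity of graphs\<close>

definition generically_redundantly_rigid :: "'n::finite itself \<Rightarrow> 'a graph \<Rightarrow> bool" where
  "generically_redundantly_rigid _ G \<longleftrightarrow>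
     (\<forall>p :: 'a \<Rightarrow> real ^ 'n. generic G p \<longrightarrow> redundantly_rigid G p)"

definition generically_globally_rigid :: "'n::finite itself \<Rightarrow> 'a graph \<Rightarrow> bool" where
  "generically_globally_rigid _ G \<longleftrightarrow>
     (\<forall>p :: 'a \<Rightarrow> real ^ 'n. generic G p \<longrightarrow> globally_rigid G p)"

definition generically_partially_rigid :: "'n::finite itself \<Rightarrow> 'a graph \<Rightarrow> bool" where
  "generically_partially_rigid d G \<longleftrightarrow>
     vertex_connected (CARD('n) + 1) G \<and>
     generically_redundantly_rigid d G \<and>
     \<not> generically_globally_rigid d G"

end

theory Submission
  imports Defs
begin

text \<open>
  Take a complete graph (the body) containing two disjoint sets of \<open>d - 2\<close> vertices, the left and
  the right anchors. Add four vertices joined to the right anchors and five vertices joined to the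
  left anchors, and join each of the four to each of the five. Adding vertices to the body makes
  the family infinite.

  Redundancy: bipartite edges lie in a complete bipartite graph with parts of size \<open>d + 2\<close>, body edges
  in a complete graph on \<open>d + 2\<close> vertices; products of affine dependencies give a stress that is
  nonzero on every edge of these graphs. So removing one edge of an infinitesimally rigid generic
  framework leaves the space of infinitesimal flexes unchanged.

  Failure of global rigidity: if all anchors lie in a hyperplane, reflecting the nine free vertices
  in it gives an equivalent, noncongruent framework. Drop two of the edges between free vertices.
  The remaining \<open>9 d\<close> lengths at the free vertices form a nonsingular square system, so by an
  implicit function argument the second solution survives moving the anchors off the hyperplane. The
  affine dependency of the left part then forces the lengths of the two dropped edges to agree as
  well.
\<close>

section \<open>Rational polynomial functions and generic points\<close>

text \<open>Why four and five: with \<open>a\<close> left and \<open>b\<close> right free vertices,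
  each having \<open>d - 2\<close> anchors, the number of edges at free vertices is
  \<open>(a + b) * d + (a - 2) * (b - 2) - 4\<close>. For \<open>a = b = 4\<close> this equals the
  number of unknowns, but the product stress of the two sides of size \<open>d + 2\<close> costs one
  rank, so the framework would flex. A fifth right vertex gives a surplus of two edges. Both are
  implied lengths: the left side of \<open>d + 2\<close> vertices carries one affine dependency, and
  the right side has two vertices beyond a frame of \<open>d + 1\<close>. The obstacle is that the
  reflection needs a nongeneric position, so nonsingularity must be checked there by hand. The
  configuration \<open>base\<close> does this; since nonsingularity is a polynomial condition, the
  same computation also covers every generic point, as redundancy requires. In \<open>base\<close>
  the directions of either set of anchors span \<open>d - 3\<close> dimensions. The two orthogonal
  complements, each of dimension three, share only the reflected axis and together span five
  dimensions, which fit since \<open>d >= 5\<close>.\<close>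

lemma mpoly_eval_superset:
  assumes "finite A" "Poly_Mapping.keys P \<subseteq> A"
  shows "mpoly_eval x P = (\<Sum>m\<in>A. of_rat (Poly_Mapping.lookup P m) *
           (\<Prod>i\<in>Poly_Mapping.keys m. x i ^ Poly_Mapping.lookup m i))"
  unfolding mpoly_eval_def
  by (rule sum.mono_neutral_left) (use assms in \<open>auto simp: in_keys_iff\<close>)

lemma mpoly_eval_zero [simp]: "mpoly_eval x 0 = 0"
  by (simp add: mpoly_eval_def)

lemma mpoly_eval_add: "mpoly_eval x (P + Q) = mpoly_eval x P + mpoly_eval x Q"
proof -
  let ?A = "Poly_Mapping.keys P \<union> Poly_Mapping.keys Q"
  have "Poly_Mapping.keys (P + Q) \<subseteq> ?A" by (rule keys_add)
  then show ?thesis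
    by (simp add: mpoly_eval_superset[of ?A] lookup_add of_rat_add distrib_right sum.distrib)
qed

lemma mpoly_eval_sum: "mpoly_eval x (\<Sum>k\<in>K. P k) = (\<Sum>k\<in>K. mpoly_eval x (P k))"
  by (induction K rule: infinite_finite_induct) (auto simp: mpoly_eval_add)

lemma mpoly_eval_single:
  "mpoly_eval x (Poly_Mapping.single m c) =
     of_rat c * (\<Prod>i\<in>Poly_Mapping.keys m. x i ^ Poly_Mapping.lookup m i)"
  by (cases "c = 0") (auto simp: mpoly_eval_def)

lemma monomial_eval_superset:
  fixes x :: "'i \<Rightarrow> real"
  assumes "finite A" "Poly_Mapping.keys m \<subseteq> A"
  shows "(\<Prod>i\<in>Poly_Mapping.keys m. x i ^ Poly_Mapping.lookup m i) =
         (\<Prod>i\<in>A. x i ^ Poly_Mapping.lookup m i)"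
  by (rule prod.mono_neutral_left) (use assms in \<open>auto simp: in_keys_iff\<close>)

lemma monomial_eval_add:
  fixes x :: "'i \<Rightarrow> real"
  shows "(\<Prod>i\<in>Poly_Mapping.keys (m + m'). x i ^ Poly_Mapping.lookup (m + m') i) =
    (\<Prod>i\<in>Poly_Mapping.keys m. x i ^ Poly_Mapping.lookup m i) *
    (\<Prod>i\<in>Poly_Mapping.keys m'. x i ^ Poly_Mapping.lookup m' i)"
proof -
  let ?A = "Poly_Mapping.keys m \<union> Poly_Mapping.keys m'"
  have "Poly_Mapping.keys (m + m') \<subseteq> ?A" by (rule keys_add)
  then show ?thesis
    by (subst (1 2 3) monomial_eval_superset[of ?A]) (auto simp: lookup_add power_add prod.distrib)
qed

text \<open>A property of functions rather than of coefficient maps, so that sums, products and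
  determinants can be treated by closure rules. The bound \<open>I\<close> on the variables matters
  because genericity speaks only of coordinates of vertices.\<close>

definition rat_polyfun :: "'i set \<Rightarrow> (('i \<Rightarrow> real) \<Rightarrow> real) \<Rightarrow> bool" where
  "rat_polyfun I F \<longleftrightarrow> (\<exists>P :: 'i rat_mpoly.
     (\<forall>m\<in>Poly_Mapping.keys P. Poly_Mapping.keys m \<subseteq> I) \<and> (\<forall>x. mpoly_eval x P = F x))"

lemma rat_polyfun_const: "rat_polyfun I (\<lambda>x. of_rat c)"
  unfolding rat_polyfun_def
  by (rule exI[of _ "Poly_Mapping.single 0 c"]) (auto simp: mpoly_eval_single)

lemma rat_polyfun_0: "rat_polyfun I (\<lambda>x. 0)" and rat_polyfun_1: "rat_polyfun I (\<lambda>x. 1)"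
  using rat_polyfun_const[of I 0] rat_polyfun_const[of I 1] by simp_all

lemma rat_polyfun_var: "i \<in> I \<Longrightarrow> rat_polyfun I (\<lambda>x. x i)"
  unfolding rat_polyfun_def
  by (rule exI[of _ "Poly_Mapping.single (Poly_Mapping.single i 1) 1"])
    (auto simp: mpoly_eval_single)

lemma rat_polyfun_add:
  assumes "rat_polyfun I F" "rat_polyfun I G"
  shows "rat_polyfun I (\<lambda>x. F x + G x)"
proof -
  obtain P Q where "\<forall>m\<in>Poly_Mapping.keys P. Poly_Mapping.keys m \<subseteq> I" "\<forall>x. mpoly_eval x P = F x"
    "\<forall>m\<in>Poly_Mapping.keys Q. Poly_Mapping.keys m \<subseteq> I" "\<forall>x. mpoly_eval x Q = G x"
    using assms unfolding rat_polyfun_def by blast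
  then show ?thesis
    unfolding rat_polyfun_def
    by (intro exI[of _ "P + Q"]) (use keys_add[of P Q] in \<open>fastforce simp: mpoly_eval_add\<close>)
qed

lemma rat_polyfun_sum:
  "(\<And>k. k \<in> K \<Longrightarrow> rat_polyfun I (F k)) \<Longrightarrow> rat_polyfun I (\<lambda>x. \<Sum>k\<in>K. F k x)"
  by (induction K rule: infinite_finite_induct) (auto intro: rat_polyfun_0 rat_polyfun_add)

lemma rat_polyfun_mult:
  assumes "rat_polyfun I F" "rat_polyfun I G"
  shows "rat_polyfun I (\<lambda>x. F x * G x)"
proof -
  obtain P Q where P: "\<forall>m\<in>Poly_Mapping.keys P. Poly_Mapping.keys m \<subseteq> I" "\<And>x. mpoly_eval x P = F x"
    and Q: "\<forall>m\<in>Poly_Mapping.keys Q. Poly_Mapping.keys m \<subseteq> I" "\<And>x. mpoly_eval x Q = G x"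
    using assms unfolding rat_polyfun_def by blast
  let ?c = "\<lambda>m m'. Poly_Mapping.single (m + m') (Poly_Mapping.lookup P m * Poly_Mapping.lookup Q m')"
  have "rat_polyfun I (\<lambda>x. mpoly_eval x (?c m m'))"
    if "m \<in> Poly_Mapping.keys P" "m' \<in> Poly_Mapping.keys Q" for m m'
  proof -
    have "Poly_Mapping.keys (m + m') \<subseteq> I" using P(1) Q(1) that keys_add[of m m'] by blast
    then show ?thesis
      unfolding rat_polyfun_def by (intro exI[of _ "?c m m'"]) simp
  qed
  then have "rat_polyfun I (\<lambda>x. \<Sum>m\<in>Poly_Mapping.keys P. \<Sum>m'\<in>Poly_Mapping.keys Q. mpoly_eval x (?c m m'))"
    by (intro rat_polyfun_sum)
  moreover have "F x * G x =
    (\<Sum>m\<in>Poly_Mapping.keys P. \<Sum>m'\<in>Poly_Mapping.keys Q. mpoly_eval x (?c m m'))" for x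
    unfolding P(2)[symmetric] Q(2)[symmetric] mpoly_eval_single monomial_eval_add of_rat_mult
    by (simp add: mpoly_eval_def sum_product mult_ac)
  ultimately show ?thesis by simp
qed

lemma rat_polyfun_uminus: "rat_polyfun I F \<Longrightarrow> rat_polyfun I (\<lambda>x. - F x)"
  using rat_polyfun_mult[OF rat_polyfun_const[of I "-1"], of F] by simp

lemma rat_polyfun_diff:
  "rat_polyfun I F \<Longrightarrow> rat_polyfun I G \<Longrightarrow> rat_polyfun I (\<lambda>x. F x - G x)"
  using rat_polyfun_add[of I F "\<lambda>x. - G x"] rat_polyfun_uminus by auto

lemma rat_polyfun_prod:
  "(\<And>k. k \<in> K \<Longrightarrow> rat_polyfun I (F k)) \<Longrightarrow> rat_polyfun I (\<lambda>x. \<Prod>k\<in>K. F k x)"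
  by (induction K rule: infinite_finite_induct) (auto intro: rat_polyfun_1 rat_polyfun_mult)

lemma rat_polyfun_of_int: "rat_polyfun I (\<lambda>x. of_int c)"
  using rat_polyfun_const[of I "of_int c"] by simp

lemma rat_polyfun_det:
  fixes M :: "('i \<Rightarrow> real) \<Rightarrow> real ^ 'm ^ 'm"
  assumes "\<And>k l. rat_polyfun I (\<lambda>x. M x $ k $ l)"
  shows "rat_polyfun I (\<lambda>x. det (M x))"
  unfolding det_def
  by (intro rat_polyfun_sum rat_polyfun_mult rat_polyfun_prod rat_polyfun_of_int assms)

lemma rat_polyfun_tendsto:
  assumes "rat_polyfun I F" "\<And>i. i \<in> I \<Longrightarrow> ((\<lambda>t. x t i) \<longlongrightarrow> x0 i) Fl"
  shows "((\<lambda>t. F (x t)) \<longlongrightarrow> F x0) Fl"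
proof -
  obtain P where P: "\<forall>m\<in>Poly_Mapping.keys P. Poly_Mapping.keys m \<subseteq> I" "\<And>x. F x = mpoly_eval x P"
    using assms(1) unfolding rat_polyfun_def by metis
  show ?thesis
    unfolding P(2) mpoly_eval_def
    by (intro tendsto_intros) (use P(1) assms(2) in auto)
qed

lemma rat_polyfun_generic_nonzero:
  assumes "rat_polyfun I F" "alg_independent_over_rat I x" "F x0 \<noteq> 0"
  shows "F x \<noteq> 0"
proof
  assume "F x = 0"
  obtain P where P: "\<forall>m\<in>Poly_Mapping.keys P. Poly_Mapping.keys m \<subseteq> I" "\<And>x. mpoly_eval x P = F x"
    using assms(1) unfolding rat_polyfun_def by metis
  with \<open>F x = 0\<close> assms(2) have "P = 0"
    unfolding alg_independent_over_rat_def by metis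
  then show False using P(2)[of x0] assms(3) by simp
qed

section \<open>Existence and density of generic points\<close>

lemma countable_poly_mapping:
  assumes "countable (UNIV :: 'i set)" "countable (UNIV :: 'c::zero set)"
  shows "countable (UNIV :: ('i \<Rightarrow>\<^sub>0 'c) set)"
proof -
  let ?g = "\<lambda>P :: 'i \<Rightarrow>\<^sub>0 'c. (\<lambda>m. (m, Poly_Mapping.lookup P m)) ` Poly_Mapping.keys P"
  have "inj ?g"
  proof (rule injI)
    fix P Q :: "'i \<Rightarrow>\<^sub>0 'c" assume *: "?g P = ?g Q"
    have "(m, c) \<in> ?g P \<longleftrightarrow> Poly_Mapping.lookup P m = c \<and> c \<noteq> 0" for P :: "'i \<Rightarrow>\<^sub>0 'c" and m c
      by (auto simp: in_keys_iff image_iff)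
    with * have "Poly_Mapping.lookup P m = c \<and> c \<noteq> 0 \<longleftrightarrow> Poly_Mapping.lookup Q m = c \<and> c \<noteq> 0" for m c
      by metis
    then show "P = Q" by (metis poly_mapping_eqI)
  qed
  moreover have "countable (UNIV :: ('i \<times> 'c) set)"
    using countable_SIGMA[OF assms(1), of "\<lambda>_. UNIV"] assms(2) by simp
  then have "countable {A. A \<subseteq> (UNIV :: ('i \<times> 'c) set) \<and> finite A}"
    using countable_Collect_finite_subset[of "UNIV :: ('i \<times> 'c) set"] by (simp add: conj_commute)
  then have "countable (range ?g)"
    by (rule countable_subset[rotated]) auto
  ultimately show ?thesis by (rule countable_image_inj_on[rotated])
qed

text \<open>A nonzero \<open>P\<close>, read as a polynomial in the new coordinate \<open>t\<close>,
  has some coefficient that is a nonzero rational polynomial in the old coordinates. Independence of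
  \<open>x\<close> makes its value nonzero, so \<open>P\<close> excludes only finitely many
  \<open>t\<close>, and there are countably many \<open>P\<close>.\<close>

lemma alg_dependent_extensions_countable:
  fixes x :: "'i::countable \<Rightarrow> real"
  assumes ind: "alg_independent_over_rat I x" and "i \<notin> I"
  shows "countable {t. \<not> alg_independent_over_rat (insert i I) (x(i := t))}"
proof -
  let ?PP = "{P :: 'i rat_mpoly. P \<noteq> 0 \<and> (\<forall>m\<in>Poly_Mapping.keys P. Poly_Mapping.keys m \<subseteq> insert i I)}"
  have "finite {t. mpoly_eval (x(i := t)) P = 0}" if "P \<in> ?PP" for P
  proof -
    from that have P: "P \<noteq> 0" "\<And>m. m \<in> Poly_Mapping.keys P \<Longrightarrow> Poly_Mapping.keys m \<subseteq> insert i I" by auto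
    \<comment> \<open>\<open>e m\<close> is the exponent of the new variable in \<open>m\<close> and
      \<open>r m\<close> is the monomial without it; together they determine
      \<open>m\<close>.\<close>
    define e where "e = (\<lambda>m :: 'i \<Rightarrow>\<^sub>0 nat. Poly_Mapping.lookup m i)"
    define r where "r = (\<lambda>m :: 'i \<Rightarrow>\<^sub>0 nat. m - Poly_Mapping.single i (e m))"
    have r: "Poly_Mapping.lookup (r m) j = (if j = i then 0 else Poly_Mapping.lookup m j)" for m j
      by (auto simp: r_def e_def lookup_minus lookup_single)
    have r_inj: "m = m'" if "r m = r m'" "e m = e m'" for m m'
    proof (rule poly_mapping_eqI)
      fix j show "Poly_Mapping.lookup m j = Poly_Mapping.lookup m' j"
        using arg_cong[OF that(1), of "\<lambda>m. Poly_Mapping.lookup m j"] that(2)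
        by (cases "j = i") (auto simp: r e_def)
    qed
    have keys_r: "Poly_Mapping.keys (r m) = Poly_Mapping.keys m - {i}" for m
      by (auto simp: in_keys_iff r split: if_splits)
    have mono: "(\<Prod>j\<in>Poly_Mapping.keys m. (x(i := t)) j ^ Poly_Mapping.lookup m j) =
       (\<Prod>j\<in>Poly_Mapping.keys (r m). x j ^ Poly_Mapping.lookup (r m) j) * t ^ e m" for m t
    proof -
      have "(\<Prod>j\<in>Poly_Mapping.keys m. (x(i := t)) j ^ Poly_Mapping.lookup m j) =
        (\<Prod>j\<in>insert i (Poly_Mapping.keys m - {i}). (x(i := t)) j ^ Poly_Mapping.lookup m j)"
        by (intro monomial_eval_superset) auto
      also have "\<dots> = t ^ e m * (\<Prod>j\<in>Poly_Mapping.keys m - {i}. x j ^ Poly_Mapping.lookup m j)"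
        by (subst prod.insert) (auto simp: e_def intro!: prod.cong)
      also have "(\<Prod>j\<in>Poly_Mapping.keys m - {i}. x j ^ Poly_Mapping.lookup m j) =
         (\<Prod>j\<in>Poly_Mapping.keys (r m). x j ^ Poly_Mapping.lookup (r m) j)"
        unfolding keys_r by (intro prod.cong) (auto simp: r)
      finally show ?thesis by simp
    qed
    \<comment> \<open>The coefficient of \<open>t ^ k\<close>, as a polynomial in the old
      variables.\<close>
    define C where "C = (\<lambda>k. \<Sum>m | m \<in> Poly_Mapping.keys P \<and> e m = k.
       Poly_Mapping.single (r m) (Poly_Mapping.lookup P m))"
    define N where "N = Max (e ` Poly_Mapping.keys P)"
    have eval: "mpoly_eval (x(i := t)) P = (\<Sum>k\<le>N. mpoly_eval x (C k) * t ^ k)" for t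
    proof -
      have "mpoly_eval (x(i := t)) P =
        (\<Sum>m\<in>Poly_Mapping.keys P. mpoly_eval x (Poly_Mapping.single (r m) (Poly_Mapping.lookup P m)) * t ^ e m)"
        unfolding mpoly_eval_def[of "x(i := t)"] mono mpoly_eval_single by (simp add: mult_ac)
      also have "\<dots> = (\<Sum>k\<le>N. \<Sum>m | m \<in> Poly_Mapping.keys P \<and> e m = k.
           mpoly_eval x (Poly_Mapping.single (r m) (Poly_Mapping.lookup P m)) * t ^ e m)"
        by (rule sum.group[symmetric]) (auto simp: N_def)
      also have "\<dots> = (\<Sum>k\<le>N. mpoly_eval x (C k) * t ^ k)"
        by (intro sum.cong) (auto simp: C_def mpoly_eval_sum sum_distrib_right)
      finally show ?thesis .
    qed
    obtain m0 where m0: "m0 \<in> Poly_Mapping.keys P"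
      using P(1) by (metis keys_eq_empty ex_in_conv)
    \<comment> \<open>No cancellation: monomials with equal exponent \<open>e\<close> have distinct
      remainders \<open>r\<close>, so only \<open>m0\<close> contributes.\<close>
    have "Poly_Mapping.lookup (C (e m0)) (r m0) =
       (\<Sum>m | m \<in> Poly_Mapping.keys P \<and> e m = e m0. if m = m0 then Poly_Mapping.lookup P m else 0)"
      unfolding C_def lookup_sum using r_inj by (intro sum.cong) (auto simp: lookup_single when_def)
    also have "\<dots> = Poly_Mapping.lookup P m0"
      using m0 by (subst sum.delta) auto
    finally have "C (e m0) \<noteq> 0" using m0 by (auto simp: in_keys_iff)
    moreover have "\<forall>m\<in>Poly_Mapping.keys (C k). Poly_Mapping.keys m \<subseteq> I" for k
    proof
      fix m assume "m \<in> Poly_Mapping.keys (C k)"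
      then obtain m' where "m' \<in> Poly_Mapping.keys P" "m = r m'"
        unfolding C_def using keys_sum by (fastforce split: if_splits)
      then show "Poly_Mapping.keys m \<subseteq> I"
        using P(2) by (auto simp: keys_r)
    qed
    ultimately have "mpoly_eval x (C (e m0)) \<noteq> 0"
      using ind unfolding alg_independent_over_rat_def by metis
    moreover have "e m0 \<le> N" unfolding N_def using m0 by auto
    ultimately show ?thesis unfolding eval polyfun_finite_roots by blast
  qed
  moreover have "countable (UNIV :: 'i rat_mpoly set)"
    by (intro countable_poly_mapping) auto
  then have "countable ?PP" by (rule countable_subset[rotated]) auto
  ultimately have "countable (\<Union>P\<in>?PP. {t. mpoly_eval (x(i := t)) P = 0})"
    by (intro countable_UN) (auto intro: countable_finite)
  then show ?thesis
    by (rule countable_subset[rotated]) (auto simp: alg_independent_over_rat_def)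
qed

text \<open>Coordinates are adjoined one at a time: an interval is uncountable, while only countably
  many values destroy independence.\<close>

lemma alg_independent_dense:
  fixes x0 :: "'i::countable \<Rightarrow> real"
  assumes "finite I" "\<epsilon> > 0"
  obtains x where "alg_independent_over_rat I x" "\<And>i. i \<in> I \<Longrightarrow> \<bar>x i - x0 i\<bar> < \<epsilon>"
proof -
  from assms(1) have "\<exists>x. alg_independent_over_rat I x \<and> (\<forall>i\<in>I. \<bar>x i - x0 i\<bar> < \<epsilon>)"
  proof (induction I)
    case empty
    have "alg_independent_over_rat {} x0"
      unfolding alg_independent_over_rat_def
    proof (intro allI impI, elim conjE)
      fix P :: "'i rat_mpoly"
      assume *: "\<forall>m\<in>Poly_Mapping.keys P. Poly_Mapping.keys m \<subseteq> {}" "mpoly_eval x0 P = 0"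
      then have 0: "m = 0" if "m \<in> Poly_Mapping.keys P" for m
        using that by (metis keys_eq_empty subset_empty)
      then have "mpoly_eval x0 P = of_rat (Poly_Mapping.lookup P 0)"
        by (subst mpoly_eval_superset[of "{0}"]) auto
      with *(2) have "Poly_Mapping.lookup P 0 = 0" by simp
      with 0 show "P = 0" by (metis in_keys_iff keys_eq_empty ex_in_conv)
    qed
    then show ?case by auto
  next
    case (insert i I)
    then obtain x where x: "alg_independent_over_rat I x" "\<forall>j\<in>I. \<bar>x j - x0 j\<bar> < \<epsilon>" by auto
    let ?bad = "{t. \<not> alg_independent_over_rat (insert i I) (x(i := t))}"
    have "countable ?bad" by (rule alg_dependent_extensions_countable) (use x insert in auto)
    moreover have "uncountable {x0 i <..< x0 i + \<epsilon>}"
      using assms(2) uncountable_open_interval by auto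
    ultimately obtain t where "t \<in> {x0 i <..< x0 i + \<epsilon>}" "t \<notin> ?bad"
      by (metis countable_subset subsetI)
    then show ?case
      using x insert by (intro exI[of _ "x(i := t)"]) (auto simp del: fun_upd_apply, auto)
  qed
  then show thesis using that by blast
qed

section \<open>Zariski open conditions and affine frames\<close>

text \<open>A single polynomial inequation suffices, since each condition needed below is the
  nonvanishing of one determinant. It is used in two ways: validity at one point spreads to all
  generic points, and validity at any point spreads to a neighbourhood.\<close>

definition zariski_open :: "'a set \<Rightarrow> (('a \<Rightarrow> real ^ 'n) \<Rightarrow> bool) \<Rightarrow> bool" where
  "zariski_open V C \<longleftrightarrow>
     (\<exists>F. rat_polyfun (V \<times> UNIV) F \<and> (\<forall>m. C m \<longleftrightarrow> F (\<lambda>(i, k). m i $ k) \<noteq> 0))"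

text \<open>Nonvanishing at the witness \<open>m0\<close> shows that the polynomial is not zero, so
  it cannot vanish at algebraically independent coordinates.\<close>

lemma zariski_open_generic:
  assumes "zariski_open V C" "C m0" "alg_independent_over_rat (V \<times> UNIV) (\<lambda>(i, k). m i $ k)"
  shows "C m"
  using assms rat_polyfun_generic_nonzero unfolding zariski_open_def by blast

lemma zariski_open_near:
  fixes m0 :: "'a \<Rightarrow> real ^ 'n"
  assumes "zariski_open V C" "C m0"
  obtains \<epsilon> where "\<epsilon> > 0" "\<And>m. (\<And>i. i \<in> V \<Longrightarrow> norm (m i - m0 i) < \<epsilon>) \<Longrightarrow> C m"
proof (rule ccontr)
  assume "\<not> thesis"
  with that have "\<forall>n. \<exists>m. (\<forall>i\<in>V. norm (m i - m0 i) < 1 / real (Suc n)) \<and> \<not> C m"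
    by (metis of_nat_0_less_iff zero_less_Suc zero_less_divide_1_iff)
  then obtain m where m: "\<And>n i. i \<in> V \<Longrightarrow> norm (m n i - m0 i) < 1 / real (Suc n)" "\<And>n. \<not> C (m n)"
    by metis
  obtain F where F: "rat_polyfun (V \<times> UNIV) F" "\<And>m. C m \<longleftrightarrow> F (\<lambda>(i, k). m i $ k) \<noteq> 0"
    using assms(1) unfolding zariski_open_def by auto
  have "(\<lambda>n. m n i) \<longlonglongrightarrow> m0 i" if "i \<in> V" for i
  proof -
    have "(\<lambda>n. m n i - m0 i) \<longlonglongrightarrow> 0"
    proof (rule Lim_null_comparison[OF _ LIMSEQ_inverse_real_of_nat])
      show "\<forall>\<^sub>F n in sequentially. norm (m n i - m0 i) \<le> inverse (real (Suc n))"
        using m(1)[OF that] by (intro always_eventually allI less_imp_le) (simp only: inverse_eq_divide)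
    qed
    then show ?thesis by (rule LIM_zero_cancel)
  qed
  then have "(\<lambda>n. F (\<lambda>(i, k). m n i $ k)) \<longlonglongrightarrow> F (\<lambda>(i, k). m0 i $ k)"
    by (intro rat_polyfun_tendsto[OF F(1)]) (auto intro!: tendsto_vec_nth)
  moreover have "(\<lambda>n. F (\<lambda>(i, k). m n i $ k)) = (\<lambda>n. 0)"
    using m(2) F(2) by auto
  ultimately have "F (\<lambda>(i, k). m0 i $ k) = 0"
    by (simp add: LIMSEQ_const_iff)
  then show False using F(2) assms(2) by auto
qed

text \<open>Injectivity of a linear system \<open>R u = 0\<close> is the nonvanishing of \<open>det (R\<^sup>T R)\<close>.\<close>

lemma zariski_open_linear_system:
  fixes r :: "'k \<Rightarrow> ('a \<Rightarrow> real ^ 'n) \<Rightarrow> real ^ 'm"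
  assumes "finite K"
    and r: "\<And>k l. k \<in> K \<Longrightarrow> \<exists>F. rat_polyfun (V \<times> UNIV) F \<and> (\<forall>m. r k m $ l = F (\<lambda>(i, k). m i $ k))"
  shows "zariski_open V (\<lambda>m. \<forall>u. (\<forall>k\<in>K. r k m \<bullet> u = 0) \<longrightarrow> u = 0)"
proof -
  obtain f where f: "\<And>k l. k \<in> K \<Longrightarrow> rat_polyfun (V \<times> UNIV) (f k l)"
    "\<And>k l m. k \<in> K \<Longrightarrow> r k m $ l = f k l (\<lambda>(i, k). m i $ k)"
    using r by metis
  define M where "M = (\<lambda>x. (\<chi> l l'. \<Sum>k\<in>K. f k l x * f k l' x) :: real ^ 'm ^ 'm)"
  have pf: "rat_polyfun (V \<times> UNIV) (\<lambda>x. det (M x))"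
    by (rule rat_polyfun_det) (auto simp: M_def intro!: rat_polyfun_sum rat_polyfun_mult f)
  have "(\<forall>u. (\<forall>k\<in>K. r k m \<bullet> u = 0) \<longrightarrow> u = 0) \<longleftrightarrow> det (M (\<lambda>(i, k). m i $ k)) \<noteq> 0" for m
  proof -
    define A where "A = M (\<lambda>(i, k). m i $ k)"
    have Av: "A *v u = (\<Sum>k\<in>K. (r k m \<bullet> u) *\<^sub>R r k m)" for u
    proof -
      have "(A *v u) $ l = (\<Sum>k\<in>K. (r k m \<bullet> u) *\<^sub>R r k m) $ l" for l
      proof -
        have "(A *v u) $ l = (\<Sum>l'\<in>UNIV. \<Sum>k\<in>K. r k m $ l * r k m $ l' * u $ l')"
          by (simp add: A_def M_def matrix_vector_mult_def f(2)[symmetric] sum_distrib_right)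
        also have "\<dots> = (\<Sum>k\<in>K. \<Sum>l'\<in>UNIV. r k m $ l * r k m $ l' * u $ l')"
          by (rule sum.swap)
        also have "\<dots> = (\<Sum>k\<in>K. (r k m \<bullet> u) * r k m $ l)"
          by (simp add: inner_vec_def sum_distrib_right sum_distrib_left mult_ac)
        finally show ?thesis by simp
      qed
      then show ?thesis by (simp add: vec_eq_iff)
    qed
    have "A *v u = 0 \<longleftrightarrow> (\<forall>k\<in>K. r k m \<bullet> u = 0)" for u
    proof
      assume "A *v u = 0"
      then have "0 = u \<bullet> (A *v u)" by simp
      also have "\<dots> = (\<Sum>k\<in>K. (r k m \<bullet> u)\<^sup>2)"
        by (simp add: Av inner_sum_right inner_commute power2_eq_square)
      finally show "\<forall>k\<in>K. r k m \<bullet> u = 0"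
        using assms(1) by (metis (mono_tags, lifting) sum_nonneg_eq_0_iff zero_eq_power2 zero_le_power2)
    qed (simp add: Av)
    moreover have "det A \<noteq> 0 \<longleftrightarrow> (\<forall>u. A *v u = 0 \<longrightarrow> u = 0)"
      by (metis invertible_det_nz invertible_left_inverse matrix_left_invertible_ker)
    ultimately show ?thesis by (simp add: A_def)
  qed
  with pf show ?thesis unfolding zariski_open_def by blast
qed

text \<open>Stated for indexed families, so coinciding points count as dependent, and as a
  homogeneous linear system in \<open>c\<close>, the form to which
  \<open>zariski_open_linear_system\<close> applies.\<close>

definition affinely_indep :: "'a set \<Rightarrow> ('a \<Rightarrow> 'b::real_vector) \<Rightarrow> bool" where
  "affinely_indep X m \<longleftrightarrow>
     (\<forall>c. sum c X = 0 \<and> (\<Sum>i\<in>X. c i *\<^sub>R m i) = 0 \<longrightarrow> (\<forall>i\<in>X. c i = 0))"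

lemma zariski_open_affinely_indep:
  assumes "card X = CARD('n) + 1" "X \<subseteq> V"
  shows "zariski_open V (\<lambda>m :: 'a \<Rightarrow> real ^ 'n. affinely_indep X m)"
proof -
  have "finite X" using assms(1) by (metis card.infinite Suc_eq_plus1 nat.distinct(1))
  have "card (UNIV :: 'n option set) = card X" using assms(1) by simp
  then obtain h :: "'n option \<Rightarrow> 'a" where h: "bij_betw h UNIV X"
    using \<open>finite X\<close> finite_same_card_bij[of "UNIV :: 'n option set" X] by auto
  \<comment> \<open>Rows and columns are both indexed by \<open>'n option\<close>: row
    \<open>None\<close> consists of ones and says that the coefficients sum to zero, row
    \<open>Some k\<close> is coordinate \<open>k\<close> of the vector equation.\<close>
  define r where "r = (\<lambda>l (m :: 'a \<Rightarrow> real ^ 'n). \<chi> j :: 'n option. case l of None \<Rightarrow> 1 | Some k \<Rightarrow> m (h j) $ k)"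
  have hX: "h j \<in> X" for j using h by (auto simp: bij_betw_def)
  have "zariski_open V (\<lambda>m. \<forall>u. (\<forall>l\<in>UNIV. r l m \<bullet> u = 0) \<longrightarrow> u = 0)"
  proof (rule zariski_open_linear_system)
    fix l :: "'n option" and j :: "'n option"
    have "rat_polyfun (V \<times> UNIV) (\<lambda>x. case l of None \<Rightarrow> 1 | Some k \<Rightarrow> x (h j, k))"
      using hX assms(2) by (cases l) (auto intro: rat_polyfun_1 rat_polyfun_var)
    then show "\<exists>F. rat_polyfun (V \<times> UNIV) F \<and> (\<forall>m. r l m $ j = F (\<lambda>(i, k). m i $ k))"
      by (intro exI conjI, assumption) (simp add: r_def split: option.split)
  qed auto
  moreover have "(\<forall>u. (\<forall>l\<in>UNIV. r l m \<bullet> u = 0) \<longrightarrow> u = 0) \<longleftrightarrow> affinely_indep X m" for m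
  proof -
    have 1: "(\<forall>l\<in>UNIV. r l m \<bullet> u = 0) \<longleftrightarrow>
      sum c X = 0 \<and> (\<Sum>i\<in>X. c i *\<^sub>R m i) = 0" if "\<And>j. c (h j) = u $ j" for c and u :: "real ^ 'n option"
    proof -
      have "sum c X = r None m \<bullet> u"
        unfolding sum.reindex_bij_betw[OF h, symmetric] that by (simp add: r_def inner_vec_def)
      moreover have "(\<Sum>i\<in>X. c i *\<^sub>R m i) $ k = r (Some k) m \<bullet> u" for k
        unfolding sum.reindex_bij_betw[OF h, symmetric] that
        by (simp add: r_def inner_vec_def mult.commute)
      ultimately show ?thesis
        unfolding vec_eq_iff zero_index by (metis UNIV_I option.exhaust)
    qed
    show ?thesis
    proof
      assume *: "\<forall>u. (\<forall>l\<in>UNIV. r l m \<bullet> u = 0) \<longrightarrow> u = 0"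
      show "affinely_indep X m"
        unfolding affinely_indep_def
      proof (intro allI impI ballI)
        fix c i assume "sum c X = 0 \<and> (\<Sum>i\<in>X. c i *\<^sub>R m i) = 0" "i \<in> X"
        with 1[of c "\<chi> j. c (h j)"] * have "(\<chi> j. c (h j)) = 0" by simp
        moreover obtain j where "i = h j" using \<open>i \<in> X\<close> h by (auto simp: bij_betw_def)
        ultimately show "c i = 0" by (simp add: vec_eq_iff)
      qed
    next
      assume *: "affinely_indep X m"
      show "\<forall>u. (\<forall>l\<in>UNIV. r l m \<bullet> u = 0) \<longrightarrow> u = 0"
      proof (intro allI impI)
        fix u :: "real ^ 'n option" assume u: "\<forall>l\<in>UNIV. r l m \<bullet> u = 0"
        define c where "c = (\<lambda>i. u $ (the_inv h i))"
        have c: "c (h j) = u $ j" for j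
          using h by (simp add: c_def bij_betw_def the_inv_f_f)
        with 1 u * have "\<forall>i\<in>X. c i = 0" unfolding affinely_indep_def by blast
        then show "u = 0" using c hX by (simp add: vec_eq_iff)
      qed
    qed
  qed
  ultimately show ?thesis by simp
qed

lemma affinely_indep_exists:
  assumes "card X = CARD('n) + 1"
  obtains m :: "'a \<Rightarrow> real ^ 'n" where "affinely_indep X m"
proof -
  have "finite X" using assms(1) by (metis card.infinite Suc_eq_plus1 nat.distinct(1))
  have "card (UNIV :: 'n option set) = card X" using assms(1) by simp
  then obtain h :: "'n option \<Rightarrow> 'a" where h: "bij_betw h UNIV X"
    using \<open>finite X\<close> finite_same_card_bij[of "UNIV :: 'n option set" X] by auto
  define m :: "'a \<Rightarrow> real ^ 'n" where
    "m = (\<lambda>i. case the_inv h i of None \<Rightarrow> 0 | Some k \<Rightarrow> axis k 1)"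
  have m: "m (h None) = 0" "m (h (Some k)) = axis k 1" for k
    using h by (simp_all add: m_def bij_betw_def the_inv_f_f)
  have "affinely_indep X m"
    unfolding affinely_indep_def
  proof (intro allI impI, elim conjE)
    fix c assume c: "sum c X = 0" "(\<Sum>i\<in>X. c i *\<^sub>R m i) = 0"
    have "(\<Sum>j\<in>UNIV. c (h j) *\<^sub>R m (h j)) = 0"
      using c(2) unfolding sum.reindex_bij_betw[OF h, symmetric] .
    then have "(\<Sum>k\<in>UNIV. c (h (Some k)) *\<^sub>R axis k (1::real)) = 0"
      by (simp add: UNIV_option_conv sum.reindex m)
    then have "(\<Sum>k\<in>UNIV. c (h (Some k)) *\<^sub>R axis k (1::real)) $ k = 0" for k
      by simp
    then have s: "c (h (Some k)) = 0" for k
      by (simp add: axis_def if_distrib sum.delta cong: if_cong)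
    moreover have "(\<Sum>j\<in>UNIV. c (h j)) = 0"
      using c(1) unfolding sum.reindex_bij_betw[OF h, symmetric] .
    then have "c (h None) = 0" by (simp add: UNIV_option_conv sum.reindex s)
    ultimately have "c (h j) = 0" for j by (cases j) auto
    then show "\<forall>i\<in>X. c i = 0" using h by (auto simp: bij_betw_def)
  qed
  then show thesis by (rule that)
qed

section \<open>Extending maps and motions from an affine frame\<close>

lemma affinely_indep_frame:
  fixes m :: "'a \<Rightarrow> real ^ 'n"
  assumes "affinely_indep X m" "card X = CARD('n) + 1" "i0 \<in> X"
  defines "f \<equiv> \<lambda>i. m i - m i0"
  shows "inj_on f (X - {i0})" "independent (f ` (X - {i0}))" "span (f ` (X - {i0})) = UNIV"
proof -
  have fin: "finite X" using assms(2) by (metis card.infinite Suc_eq_plus1 nat.distinct(1))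
  have zero: "c i = 0" if c: "(\<Sum>i\<in>X - {i0}. c i *\<^sub>R f i) = 0" "i \<in> X - {i0}" for c i
  proof -
    \<comment> \<open>A relation between the differences \<open>f i\<close> becomes an affine one
      once \<open>i0\<close> receives the weight that makes the total zero.\<close>
    define c' where "c' = c(i0 := - sum c (X - {i0}))"
    have "sum c' (X - {i0}) = sum c (X - {i0})" by (intro sum.cong) (auto simp: c'_def)
    then have 1: "sum c' X = 0"
      using fin assms(3) by (simp add: sum.remove[of X i0]) (simp add: c'_def)
    have "(\<Sum>i\<in>X - {i0}. c' i *\<^sub>R m i) = (\<Sum>i\<in>X - {i0}. c i *\<^sub>R m i)"
      by (intro sum.cong) (auto simp: c'_def)
    then have 2: "(\<Sum>i\<in>X. c' i *\<^sub>R m i) = 0"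
      using fin assms(3) c(1)
      by (simp add: sum.remove[of X i0] f_def c'_def algebra_simps sum_subtractf scaleR_sum_left)
    from 1 2 assms(1) have "c' i = 0" using c(2) unfolding affinely_indep_def by blast
    then show "c i = 0" using c(2) by (simp add: c'_def)
  qed
  show inj: "inj_on f (X - {i0})"
  proof (rule inj_onI, rule ccontr)
    fix i j assume ij: "i \<in> X - {i0}" "j \<in> X - {i0}" "f i = f j" "i \<noteq> j"
    let ?c = "\<lambda>k. if k = i then 1 else if k = j then -1 else 0 :: real"
    have "(\<Sum>k\<in>X - {i0}. ?c k *\<^sub>R f k) = (\<Sum>k\<in>{i, j}. ?c k *\<^sub>R f k)"
      by (rule sum.mono_neutral_right) (use fin ij in auto)
    also have "\<dots> = 0" using ij by simp
    finally have "?c i = 0" using ij(1) by (rule zero)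
    then show False by simp
  qed
  show ind: "independent (f ` (X - {i0}))"
  proof (rule independent_if_scalars_zero)
    fix g x assume "(\<Sum>x\<in>f ` (X - {i0}). g x *\<^sub>R x) = 0" "x \<in> f ` (X - {i0})"
    then show "g x = 0" using zero[of "\<lambda>i. g (f i)"] by (auto simp: sum.reindex[OF inj])
  qed (use fin in auto)
  have "card (f ` (X - {i0})) = CARD('n)"
    using fin assms(2,3) by (simp add: card_image[OF inj])
  then show "span (f ` (X - {i0})) = UNIV"
    using card_ge_dim_independent[of "f ` (X - {i0})" UNIV] ind by auto
qed

lemma affinely_indep_linear_extension:
  fixes m :: "'a \<Rightarrow> real ^ 'n" and w :: "'a \<Rightarrow> real ^ 'n"
  assumes "affinely_indep X m" "card X = CARD('n) + 1" "i0 \<in> X"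
  obtains g where "linear g" "\<And>i. i \<in> X \<Longrightarrow> g (m i - m i0) = w i - w i0"
proof -
  let ?f = "\<lambda>i. m i - m i0"
  note frame = affinely_indep_frame[OF assms]
  obtain g where g: "linear g"
    "\<forall>x\<in>?f ` (X - {i0}). g x = w (the_inv_into (X - {i0}) ?f x) - w i0"
    using linear_independent_extend[OF frame(2), of "\<lambda>x. w (the_inv_into (X - {i0}) ?f x) - w i0"]
    by auto
  have "g (m i - m i0) = w i - w i0" if "i \<in> X" for i
  proof (cases "i = i0")
    case True
    then show ?thesis using g(1) by (simp add: linear_0)
  next
    case False
    then show ?thesis using g(2) that the_inv_into_f_f[OF frame(1), of i] by simp
  qed
  with g(1) show thesis by (rule that)
qed

lemma orthogonal_to_frame:
  fixes m :: "'a \<Rightarrow> real ^ 'n"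
  assumes "affinely_indep X m" "card X = CARD('n) + 1" "\<And>i j. i \<in> X \<Longrightarrow> j \<in> X \<Longrightarrow> m i \<bullet> w = m j \<bullet> w"
  shows "w = 0"
proof -
  obtain i0 where i0: "i0 \<in> X" using assms(2) by fastforce
  have "orthogonal w (m i - m i0)" if "i \<in> X" for i
    using assms(3)[OF that i0] by (simp add: orthogonal_def inner_diff_right inner_commute)
  then have "\<And>x. x \<in> (\<lambda>i. m i - m i0) ` (X - {i0}) \<Longrightarrow> orthogonal w x" by blast
  then have "orthogonal w w"
    using orthogonal_to_span affinely_indep_frame(3)[OF assms(1,2) i0] by (metis UNIV_I orthogonal_commute)
  then show ?thesis by (simp add: orthogonal_def)
qed

text \<open>The linear map \<open>A\<close> fitted to the frame is skew on frame differences by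
  polarization, hence everywhere by bilinearity. Any further vertex of \<open>B\<close> is pinned by
  its \<open>d + 1\<close> first-order constraints towards the frame.\<close>

lemma infinitesimal_motion_extension:
  fixes m v :: "'a \<Rightarrow> real ^ 'n"
  assumes X: "affinely_indep X m" "card X = CARD('n) + 1" "X \<subseteq> B"
    and flex: "\<And>i j. i \<in> B \<Longrightarrow> j \<in> B \<Longrightarrow> (m i - m j) \<bullet> (v i - v j) = 0"
  obtains A t where "linear A" "\<And>x. x \<bullet> A x = 0" "\<And>i. i \<in> B \<Longrightarrow> v i = A (m i) + t"
proof -
  obtain i0 where i0: "i0 \<in> X" using X(2) by fastforce
  let ?S = "(\<lambda>i. m i - m i0) ` (X - {i0})"
  obtain A where A: "linear A" "\<And>i. i \<in> X \<Longrightarrow> A (m i - m i0) = v i - v i0"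
    using affinely_indep_linear_extension[OF X(1,2) i0] by blast
  have Ad: "A (m i - m j) = v i - v j" if "i \<in> X" "j \<in> X" for i j
    using A(2)[OF that(1)] A(2)[OF that(2)] linear_diff[OF A(1), of "m i - m i0" "m j - m i0"] by simp
  have skew: "x \<bullet> A y + y \<bullet> A x = 0" for x y
  proof -
    have bl: "bilinear (\<lambda>x y. x \<bullet> A y + y \<bullet> A x)"
      unfolding bilinear_def
      by (auto intro!: linearI simp: linear_add[OF A(1)] linear_scale[OF A(1)] inner_add_left
          inner_add_right algebra_simps)
    have b0: "bilinear (\<lambda>x y :: real ^ 'n. 0 :: real)"
      unfolding bilinear_def by (auto intro!: linearI)
    show ?thesis
    proof (rule bilinear_eq[OF bl b0, of UNIV ?S UNIV ?S])
      show "UNIV \<subseteq> span ?S" "UNIV \<subseteq> span ?S"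
        using affinely_indep_frame(3)[OF X(1,2) i0] by auto
      fix x y assume "x \<in> ?S" "y \<in> ?S"
      then obtain i j where ij: "i \<in> X" "j \<in> X" "x = m i - m i0" "y = m j - m i0" by auto
      have "(x - y) \<bullet> A (x - y) = 0" "x \<bullet> A x = 0" "y \<bullet> A y = 0"
        using ij i0 X(3) flex by (auto simp: Ad)
      then show "x \<bullet> A y + y \<bullet> A x = 0"
        by (simp add: linear_diff[OF A(1)] inner_diff_left inner_diff_right)
    qed auto
  qed
  have skew0: "x \<bullet> A x = 0" for x using skew[of x x] by simp
  have "v i = A (m i) + (v i0 - A (m i0))" if "i \<in> B" for i
  proof -
    \<comment> \<open>The deviation of \<open>v i\<close> from the motion; it has the same inner
      product with all frame points, so \<open>orthogonal_to_frame\<close> makes it zero.\<close>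
    define w where "w = v i - v i0 - A (m i - m i0)"
    have "(m i - m j) \<bullet> w = 0" if "j \<in> X" for j
    proof -
      have "w = (v i - v j) - A (m i - m j)"
        using Ad[OF that i0] linear_diff[OF A(1), of "m i - m i0" "m j - m i0"] by (simp add: w_def)
      then show ?thesis
        using flex[of i j] \<open>i \<in> B\<close> that X(3) skew0[of "m i - m j"] by (auto simp: inner_diff_right)
    qed
    then have "w = 0" by (intro orthogonal_to_frame[OF X(1,2)]) (metis eq_iff_diff_eq_0 inner_diff_left)
    then show ?thesis by (simp add: w_def linear_diff[OF A(1)] algebra_simps)
  qed
  then show thesis using that A(1) skew0 by blast
qed

text \<open>The finite counterpart of \<open>infinitesimal_motion_extension\<close>: polarization
  turns equal distances into equal inner products of differences, so the fitted linear map is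
  orthogonal.\<close>

lemma congruence_extension:
  fixes m w :: "'a \<Rightarrow> real ^ 'n"
  assumes X: "affinely_indep X m" "card X = CARD('n) + 1" "X \<subseteq> V"
    and iso: "\<And>i j. i \<in> V \<Longrightarrow> j \<in> V \<Longrightarrow> norm (w i - w j) = norm (m i - m j)"
  obtains f a where "orthogonal_transformation f" "\<And>i. i \<in> V \<Longrightarrow> w i = a + f (m i)"
proof -
  obtain i0 where i0: "i0 \<in> X" using X(2) by fastforce
  let ?S = "(\<lambda>i. m i - m i0) ` (X - {i0})"
  obtain f where f: "linear f" "\<And>i. i \<in> X \<Longrightarrow> f (m i - m i0) = w i - w i0"
    using affinely_indep_linear_extension[OF X(1,2) i0] by blast
  have inner: "(w i - w i0) \<bullet> (w j - w i0) = (m i - m i0) \<bullet> (m j - m i0)" if "i \<in> V" "j \<in> V" for i j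
  proof -
    have "norm ((w i - w i0) - (w j - w i0)) = norm ((m i - m i0) - (m j - m i0))"
      using iso that by simp
    then show ?thesis
      using iso[of i i0] iso[of j i0] that i0 X(3)
      by (auto simp: norm_eq inner_diff_left inner_diff_right inner_commute)
  qed
  have fin: "f x \<bullet> f y = x \<bullet> y" for x y
  proof -
    have bl: "bilinear (\<lambda>x y. f x \<bullet> f y)"
      unfolding bilinear_def
      by (auto intro!: linearI simp: linear_add[OF f(1)] linear_scale[OF f(1)] inner_add_left inner_add_right)
    have b0: "bilinear (\<lambda>x y :: real ^ 'n. x \<bullet> y)"
      unfolding bilinear_def by (auto intro!: linearI simp: inner_add_left inner_add_right)
    show ?thesis
    proof (rule bilinear_eq[OF bl b0, of UNIV ?S UNIV ?S])
      show "UNIV \<subseteq> span ?S" "UNIV \<subseteq> span ?S"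
        using affinely_indep_frame(3)[OF X(1,2) i0] by auto
      fix x y assume "x \<in> ?S" "y \<in> ?S"
      then obtain i j where "i \<in> X" "j \<in> X" "x = m i - m i0" "y = m j - m i0" by auto
      then show "f x \<bullet> f y = x \<bullet> y" using inner[of i j] f(2) X(3) by auto
    qed auto
  qed
  then have orth: "orthogonal_transformation f" using f(1) by (simp add: orthogonal_transformation_def)
  have "w i = (w i0 - f (m i0)) + f (m i)" if "i \<in> V" for i
  proof -
    define z where "z = w i - w i0 - f (m i - m i0)"
    have surj: "surj f" using orth by (simp add: orthogonal_transformation_surj)
    have z0: "(w j - w i0) \<bullet> z = 0" if "j \<in> X" for j
      unfolding z_def f(2)[OF that, symmetric]
      using inner[of j i] fin[of "m j - m i0" "m i - m i0"] f(2)[OF that] \<open>i \<in> V\<close> that X(3)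
      by (auto simp: inner_diff_right)
    obtain y where y: "z = f y" using surj by auto
    have "(m j - m i0) \<bullet> y = 0" if "j \<in> X" for j
      using z0[OF that] fin[of "m j - m i0" y] f(2)[OF that] y by simp
    then have "y = 0" by (intro orthogonal_to_frame[OF X(1,2)]) (simp add: inner_diff_left)
    then have "z = 0" using y f(1) by (simp add: linear_0)
    then show ?thesis by (simp add: z_def linear_diff[OF f(1)] algebra_simps)
  qed
  with orth show thesis by (rule that)
qed

section \<open>Infinitesimal rigidity and stresses\<close>

definition infinitesimal_flex :: "'a set set \<Rightarrow> ('a \<Rightarrow> real ^ 'n) \<Rightarrow> ('a \<Rightarrow> real ^ 'n) \<Rightarrow> bool" where
  "infinitesimal_flex E m v \<longleftrightarrow> (\<forall>i j. {i, j} \<in> E \<longrightarrow> (m i - m j) \<bullet> (v i - v j) = 0)"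

text \<open>Triviality of a flex is expressed through pairs of vertices instead of skew maps, so
  that \<open>midpoint_flex\<close> converts it directly into congruence.\<close>

definition infinitesimally_rigid :: "'a graph \<Rightarrow> ('a \<Rightarrow> real ^ 'n) \<Rightarrow> bool" where
  "infinitesimally_rigid G m \<longleftrightarrow> (\<forall>v. infinitesimal_flex (edges G) m v \<longrightarrow>
     (\<forall>i\<in>verts G. \<forall>j\<in>verts G. (m i - m j) \<bullet> (v i - v j) = 0))"

text \<open>If \<open>p\<close> and \<open>q\<close> are equivalent, then \<open>p - q\<close> is an infinitesimal flex of the midpoint
  framework, and conversely a trivial flex \<open>p - q\<close> of the midpoint means congruence.\<close>

lemma midpoint_flex:
  fixes p q :: "'a \<Rightarrow> 'b::real_inner"
  shows "((1/2) *\<^sub>R (p i + q i) - (1/2) *\<^sub>R (p j + q j)) \<bullet> ((p i - q i) - (p j - q j)) = 0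
    \<longleftrightarrow> norm (p i - p j) = norm (q i - q j)"
  by (simp add: norm_eq inner_diff_left inner_diff_right inner_add_left inner_add_right inner_commute)
    (auto simp: algebra_simps)

text \<open>The times at which \<open>q t\<close> is congruent to \<open>p\<close> form a clopen
  subset of the interval. Openness comes from \<open>midpoint_flex\<close>: an equivalent framework
  close to \<open>p\<close> has its midpoint with \<open>p\<close> close to \<open>p\<close> as
  well. This is why infinitesimal rigidity is required on a whole neighbourhood.\<close>

lemma locally_rigid_if_near_infinitesimally_rigid:
  fixes p :: "'a \<Rightarrow> real ^ 'n"
  assumes fin: "finite (verts G)" and E: "\<And>e. e \<in> edges G \<Longrightarrow> e \<subseteq> verts G"
    and X: "affinely_indep X p" "card X = CARD('n) + 1" "X \<subseteq> verts G"
    and "\<epsilon> > 0"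
    and near: "\<And>m. (\<And>i. i \<in> verts G \<Longrightarrow> norm (m i - p i) < \<epsilon>) \<Longrightarrow> infinitesimally_rigid G m"
  shows "locally_rigid G p"
  unfolding locally_rigid_def
proof (intro allI impI)
  fix I q assume flexing: "flexing G p I q"
  define congr where "congr = (\<lambda>t. \<forall>i\<in>verts G. \<forall>j\<in>verts G. norm (q t i - q t j) = norm (p i - p j))"
  have cont: "continuous_on I (\<lambda>t. q t i)" if "i \<in> verts G" for i
    using flexing that by (auto simp: flexing_def intro: differentiable_imp_continuous_on)
  have edge: "norm (q t i - q t j) = norm (p i - p j)" if "t \<in> I" "{i, j} \<in> edges G" for t i j
  proof -
    have "edge_map G (q t) = edge_map G p" using flexing that by (simp add: flexing_def)
    from fun_cong[OF this, of "(i, j)"] show ?thesis using that by (simp add: edge_map_def)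
  qed
  have "closedin (top_of_set I) {t \<in> I. congr t}"
  proof -
    have "{t \<in> I. congr t} = I \<inter> (\<Inter>i\<in>verts G. \<Inter>j\<in>verts G. {t \<in> I. norm (q t i - q t j) = norm (p i - p j)})"
      by (auto simp: congr_def)
    moreover have "closedin (top_of_set I) {t \<in> I. norm (q t i - q t j) = norm (p i - p j)}"
      if "i \<in> verts G" "j \<in> verts G" for i j
      by (intro continuous_closedin_preimage_constant continuous_intros cont that)
    ultimately show ?thesis
      by (cases "verts G = {}") (auto intro!: closedin_Int closedin_INT)
  qed
  moreover have "openin (top_of_set I) {t \<in> I. congr t}"
  proof (subst openin_subopen, intro ballI)
    fix t1 assume "t1 \<in> {t \<in> I. congr t}"
    then have t1: "t1 \<in> I" "congr t1" by auto
    obtain f a where f: "orthogonal_transformation f" "\<And>i. i \<in> verts G \<Longrightarrow> q t1 i = a + f (p i)"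
      using congruence_extension[OF X, of "q t1"] t1(2) by (auto simp: congr_def)
    obtain g where g: "\<And>y. f (g y) = y" using orthogonal_transformation_surj[OF f(1)] by (metis surjD)
    let ?U = "I \<inter> (\<Inter>i\<in>verts G. {t \<in> I. norm (q t i - q t1 i) < \<epsilon>})"
    have "openin (top_of_set I) ?U"
    proof (cases "verts G = {}")
      case False
      have "openin (top_of_set I) {t \<in> I. norm (q t i - q t1 i) < \<epsilon>}" if "i \<in> verts G" for i
      proof -
        have "openin (top_of_set I) (I \<inter> (\<lambda>t. norm (q t i - q t1 i)) -` {..<\<epsilon>})"
          by (intro continuous_openin_preimage_gen continuous_intros cont that open_lessThan)
        then show ?thesis by (simp add: vimage_def Int_def)
      qed
      then show ?thesis using False fin by (intro openin_Int openin_INT2) auto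
    qed simp
    moreover have "t1 \<in> ?U" using t1 \<open>\<epsilon> > 0\<close> by auto
    moreover have "congr t" if "t \<in> ?U" for t
    proof -
      \<comment> \<open>Undoing the motion that carries \<open>p\<close> to \<open>q t1\<close>
        brings \<open>q t\<close> close to \<open>p\<close> itself, whatever the distance of
        \<open>t1\<close> from the starting time.\<close>
      define w where "w = (\<lambda>i. g (q t i - a))"
      have fnorm: "norm (f x - f y) = norm (x - y)" for x y
        using f(1) by (metis linear_diff orthogonal_transformation_def orthogonal_transformation_norm)
      have wn: "norm (w i - w j) = norm (q t i - q t j)" for i j
        using fnorm[of "w i" "w j"] by (simp add: w_def g)
      define m where "m = (\<lambda>i. (1/2) *\<^sub>R (p i + w i))"
      have "infinitesimally_rigid G m"
      proof (rule near)
        fix i assume i: "i \<in> verts G"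
        have "norm (w i - p i) = norm (q t i - q t1 i)"
          using fnorm[of "w i" "p i"] f(2)[OF i] by (simp add: w_def g algebra_simps)
        moreover have "2 *\<^sub>R (m i - p i) = w i - p i"
          by (simp add: m_def scaleR_diff_right scaleR_2)
        then have "2 * norm (m i - p i) = norm (w i - p i)"
          by (metis norm_scaleR abs_numeral)
        ultimately have "2 * norm (m i - p i) = norm (q t i - q t1 i)" by simp
        then show "norm (m i - p i) < \<epsilon>" using that i norm_ge_zero[of "m i - p i"]
          by (auto simp del: norm_ge_zero)
      qed
      moreover have "infinitesimal_flex (edges G) m (\<lambda>i. p i - w i)"
        unfolding infinitesimal_flex_def m_def midpoint_flex
        using edge that wn by auto
      ultimately have "\<forall>i\<in>verts G. \<forall>j\<in>verts G. norm (p i - p j) = norm (w i - w j)"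
        unfolding infinitesimally_rigid_def m_def midpoint_flex[symmetric] by blast
      then show "congr t" by (simp add: congr_def wn)
    qed
    ultimately show "\<exists>T. openin (top_of_set I) T \<and> t1 \<in> T \<and> T \<subseteq> {t \<in> I. congr t}"
      by (intro exI[of _ ?U]) auto
  qed
  moreover have "connected I" using flexing by (simp add: flexing_def is_interval_connected)
  moreover have "{t \<in> I. congr t} \<noteq> {}" using flexing by (auto simp: flexing_def congr_def)
  ultimately have "{t \<in> I. congr t} = I" unfolding connected_clopen by blast
  then have all: "congr t" if "t \<in> I" for t using that by auto
  show "trivial_flexing G p I q"
    unfolding trivial_flexing_def
  proof
    fix t assume "t \<in> I"
    with congruence_extension[OF X, of "q t"] all obtain f a where
      "orthogonal_transformation f" "\<And>i. i \<in> verts G \<Longrightarrow> q t i = a + f (p i)"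
      unfolding congr_def by metis
    then show "\<exists>T. euclidean_motion T \<and> (\<forall>i\<in>verts G. q t i = T (p i))"
      by (intro exI[of _ "\<lambda>x. a + f x"]) (auto simp: euclidean_motion_def)
  qed
qed

section \<open>General position, affine dependencies and product stresses\<close>

definition general_position :: "'a set \<Rightarrow> ('a \<Rightarrow> real ^ 'n) \<Rightarrow> bool" where
  "general_position V m \<longleftrightarrow> (\<forall>X\<subseteq>V. card X = CARD('n) + 1 \<longrightarrow> affinely_indep X m)"

lemma generic_general_position:
  fixes m :: "'a \<Rightarrow> real ^ 'n"
  assumes "alg_independent_over_rat (V \<times> UNIV) (\<lambda>(i, k). m i $ k)"
  shows "general_position V m"
  unfolding general_position_def
proof (intro allI impI)
  fix X assume X: "X \<subseteq> V" "card X = CARD('n) + 1"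
  obtain m0 :: "'a \<Rightarrow> real ^ 'n" where "affinely_indep X m0"
    using affinely_indep_exists[OF X(2)] by blast
  then show "affinely_indep X m"
    by (rule zariski_open_generic[OF zariski_open_affinely_indep[OF X(2,1)] _ assms])
qed

lemma general_position_near:
  fixes p :: "'a \<Rightarrow> real ^ 'n"
  assumes "finite V" "general_position V p"
  obtains \<epsilon> where "\<epsilon> > 0" "\<And>m. (\<And>i. i \<in> V \<Longrightarrow> norm (m i - p i) < \<epsilon>) \<Longrightarrow> general_position V m"
proof -
  let ?XX = "{X. X \<subseteq> V \<and> card X = CARD('n) + 1}"
  have "\<exists>\<epsilon>>0. \<forall>m. (\<forall>i\<in>V. norm (m i - p i) < \<epsilon>) \<longrightarrow> affinely_indep X m" if "X \<in> ?XX" for X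
  proof -
    have X: "X \<subseteq> V" "card X = CARD('n) + 1" using that by auto
    moreover have "affinely_indep X p" using assms(2) X by (simp add: general_position_def)
    ultimately show ?thesis
      using zariski_open_near[OF zariski_open_affinely_indep[OF X(2,1)], of p] by metis
  qed
  then have "\<forall>X\<in>?XX. \<exists>\<epsilon>. \<epsilon> > 0 \<and> (\<forall>m. (\<forall>i\<in>V. norm (m i - p i) < \<epsilon>) \<longrightarrow> affinely_indep X m)" by blast
  from bchoice[OF this] obtain e where e: "\<And>X. X \<in> ?XX \<Longrightarrow> e X > 0"
    "\<And>X m. X \<in> ?XX \<Longrightarrow> \<forall>i\<in>V. norm (m i - p i) < e X \<Longrightarrow> affinely_indep X m"
    by blast
  \<comment> \<open>The inserted \<open>1\<close> keeps the minimum defined when \<open>V\<close> is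
    too small to contain any such \<open>X\<close>.\<close>
  define \<epsilon> where "\<epsilon> = Min (insert 1 (e ` ?XX))"
  have fin: "finite (insert 1 (e ` ?XX))" using assms(1) by auto
  show thesis
  proof (rule that)
    show "\<epsilon> > 0" unfolding \<epsilon>_def using fin e(1) by (subst Min_gr_iff) auto
    fix m assume m: "\<And>i. i \<in> V \<Longrightarrow> norm (m i - p i) < \<epsilon>"
    show "general_position V m"
      unfolding general_position_def
    proof (intro allI impI)
      fix X assume "X \<subseteq> V" "card X = CARD('n) + 1"
      then have X: "X \<in> ?XX" by auto
      then have "\<epsilon> \<le> e X" unfolding \<epsilon>_def using fin by (intro Min_le) auto
      with m show "affinely_indep X m" by (intro e(2)[OF X]) (auto intro: less_le_trans)
    qed
  qed
qed

text \<open>Any \<open>d + 2\<close> points are affinely dependent. A vanishing coefficient would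
  leave a nontrivial dependency among \<open>d + 1\<close> of them, against general
  position.\<close>

lemma affine_dependency:
  fixes m :: "'a \<Rightarrow> real ^ 'n"
  assumes gp: "general_position V m" and X: "X \<subseteq> V" "card X = CARD('n) + 2"
  obtains l where "sum l X = 0" "(\<Sum>i\<in>X. l i *\<^sub>R m i) = 0" "\<And>i. i \<in> X \<Longrightarrow> l i \<noteq> 0"
proof -
  have fin: "finite X" using X(2) by (metis card.infinite add_2_eq_Suc' nat.distinct(1))
  have ind: "affinely_indep (X - {i}) m" "card (X - {i}) = CARD('n) + 1" if "i \<in> X" for i
  proof -
    show c: "card (X - {i}) = CARD('n) + 1" using X(2) fin that by simp
    have "X - {i} \<subseteq> V" using X(1) by blast
    with c gp show "affinely_indep (X - {i}) m" unfolding general_position_def by blast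
  qed
  obtain i0 where i0: "i0 \<in> X" using X(2) by fastforce
  obtain j0 where j0: "j0 \<in> X - {i0}" using ind(2)[OF i0]
    by (metis Suc_eq_plus1 all_not_in_conv card.empty nat.distinct(1))
  let ?Y = "X - {i0} - {j0}" and ?f = "\<lambda>i. m i - m j0"
  note frame = affinely_indep_frame[OF ind[OF i0] j0]
  have "m i0 - m j0 \<in> span (?f ` ?Y)" using frame(3) by simp
  then obtain u where "m i0 - m j0 = (\<Sum>x\<in>?f ` ?Y. u x *\<^sub>R x)"
    using fin by (auto simp: span_finite)
  then have u: "m i0 - m j0 = (\<Sum>i\<in>?Y. u (?f i) *\<^sub>R ?f i)"
    by (simp add: sum.reindex[OF frame(1)])
  \<comment> \<open>Weight \<open>1\<close> at \<open>i0\<close> makes the dependency nontrivial;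
    the weight at \<open>j0\<close>, the origin of the frame, is forced by total weight
    zero.\<close>
  define l where "l = (\<lambda>i. if i = i0 then 1 else if i = j0 then (\<Sum>i\<in>?Y. u (?f i)) - 1 else - u (?f i))"
  have split: "sum h X = h i0 + (h j0 + sum h ?Y)" for h :: "'a \<Rightarrow> 'c::comm_monoid_add"
    using fin i0 j0 by (simp add: sum.remove[of X i0] sum.remove[of "X - {i0}" j0])
  have lY: "(\<Sum>i\<in>?Y. h (l i) i) = (\<Sum>i\<in>?Y. h (- u (?f i)) i)" for h :: "real \<Rightarrow> 'a \<Rightarrow> 'c::comm_monoid_add"
    by (intro sum.cong) (auto simp: l_def)
  have l0: "l i0 = 1" "l j0 = (\<Sum>i\<in>?Y. u (?f i)) - 1" using j0 by (auto simp: l_def)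
  have 1: "sum l X = 0"
    unfolding split lY[of "\<lambda>c i. c"] l0 by (simp add: sum_negf)
  have 2: "(\<Sum>i\<in>X. l i *\<^sub>R m i) = 0"
    unfolding split lY[of "\<lambda>c i. c *\<^sub>R m i"] l0 using u
    by (simp add: sum_negf scaleR_diff_left scaleR_diff_right sum_subtractf scaleR_sum_left algebra_simps)
  have "l i \<noteq> 0" if "i \<in> X" for i
  proof
    assume "l i = 0"
    have "sum l (X - {i}) = 0" "(\<Sum>i\<in>X - {i}. l i *\<^sub>R m i) = 0"
      using 1 2 \<open>l i = 0\<close> by (simp_all add: sum.remove[OF fin that])
    then have "\<forall>j\<in>X - {i}. l j = 0" using ind(1)[OF that] unfolding affinely_indep_def by blast
    then have "l i0 = 0" using i0 \<open>l i = 0\<close> by auto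
    then show False by (simp add: l0)
  qed
  with 1 2 show thesis by (rule that)
qed

text \<open>The products \<open>l i * k j\<close> of two affine dependencies form an equilibrium stress.\<close>

lemma product_stress:
  fixes m v :: "'a \<Rightarrow> 'b::real_inner"
  assumes "sum l X = 0" "(\<Sum>i\<in>X. l i *\<^sub>R m i) = 0" "sum k Y = 0" "(\<Sum>j\<in>Y. k j *\<^sub>R m j) = 0"
  shows "(\<Sum>i\<in>X. \<Sum>j\<in>Y. l i * k j * ((m i - m j) \<bullet> (v i - v j))) = 0"
proof -
  define W where "W = (\<Sum>j\<in>Y. k j *\<^sub>R v j)"
  define c where "c = (\<Sum>j\<in>Y. k j * (m j \<bullet> v j))"
  have "(\<Sum>j\<in>Y. k j * ((m i - m j) \<bullet> (v i - v j))) = c - m i \<bullet> W" for i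
  proof -
    have "(\<Sum>j\<in>Y. k j * ((m i - m j) \<bullet> (v i - v j))) =
      sum k Y * (m i \<bullet> v i) - m i \<bullet> W - (\<Sum>j\<in>Y. k j *\<^sub>R m j) \<bullet> v i + c"
      by (simp add: W_def c_def inner_sum_left inner_sum_right sum_distrib_right sum_subtractf[symmetric]
          sum.distrib[symmetric] inner_diff_left inner_diff_right algebra_simps)
    then show ?thesis using assms by simp
  qed
  then have "(\<Sum>i\<in>X. \<Sum>j\<in>Y. l i * k j * ((m i - m j) \<bullet> (v i - v j))) = (\<Sum>i\<in>X. l i * (c - m i \<bullet> W))"
    by (simp add: mult.assoc sum_distrib_left[symmetric])
  also have "\<dots> = sum l X * c - (\<Sum>i\<in>X. l i *\<^sub>R m i) \<bullet> W"
    by (simp add: inner_sum_left sum_distrib_right right_diff_distrib sum_subtractf)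
  finally show ?thesis using assms by simp
qed

text \<open>In the identity of \<open>product_stress\<close> every term vanishes except those of the
  missing edge, and their weight is nonzero. \<open>X = Y\<close> treats a complete graph, disjoint
  \<open>X\<close> and \<open>Y\<close> a complete bipartite one.\<close>

lemma flex_across_missing_edge:
  fixes m v :: "'a \<Rightarrow> real ^ 'n"
  assumes gp: "general_position V m" and X: "X \<subseteq> V" "card X = CARD('n) + 2"
    and Y: "Y \<subseteq> V" "card Y = CARD('n) + 2" and XY: "X = Y \<or> X \<inter> Y = {}"
    and e: "i0 \<in> X" "j0 \<in> Y" "i0 \<noteq> j0"
    and flex: "\<And>i j. i \<in> X \<Longrightarrow> j \<in> Y \<Longrightarrow> i \<noteq> j \<Longrightarrow> {i, j} \<noteq> {i0, j0} \<Longrightarrow> (m i - m j) \<bullet> (v i - v j) = 0"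
  shows "(m i0 - m j0) \<bullet> (v i0 - v j0) = 0"
proof -
  have fin: "finite X" "finite Y" using X(2) Y(2) by (metis card.infinite add_2_eq_Suc' nat.distinct(1))+
  obtain l where l: "sum l X = 0" "(\<Sum>i\<in>X. l i *\<^sub>R m i) = 0" "\<And>i. i \<in> X \<Longrightarrow> l i \<noteq> 0"
    using affine_dependency[OF gp X] by blast
  \<comment> \<open>For \<open>X = Y\<close> the same dependency is taken twice: the ordered pairs
    \<open>(i0, j0)\<close> and \<open>(j0, i0)\<close> then have equal weights, so their
    contributions add up instead of possibly cancelling.\<close>
  obtain k where k: "sum k Y = 0" "(\<Sum>i\<in>Y. k i *\<^sub>R m i) = 0" "\<And>i. i \<in> Y \<Longrightarrow> k i \<noteq> 0" "X = Y \<Longrightarrow> k = l"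
  proof (cases "X = Y")
    case True
    then show thesis using that[of l] l by simp
  next
    case False
    then show thesis using that affine_dependency[OF gp Y] by metis
  qed
  let ?t = "\<lambda>(i, j). l i * k j * ((m i - m j) \<bullet> (v i - v j))"
  define S where "S = (X \<times> Y) \<inter> {(i0, j0), (j0, i0)}"
  have "0 = sum ?t (X \<times> Y)"
    using product_stress[OF l(1,2) k(1,2), of v] by (simp add: sum.cartesian_product)
  also have "\<dots> = sum ?t S"
  proof (rule sum.mono_neutral_right)
    have *: "(m i - m j) \<bullet> (v i - v j) = 0" if "i \<in> X" "j \<in> Y" "(i, j) \<notin> S" for i j
      using flex[of i j] that by (cases "i = j") (auto simp: doubleton_eq_iff S_def)
    show "\<forall>z\<in>X \<times> Y - S. ?t z = 0"
    proof
      fix z assume z: "z \<in> X \<times> Y - S"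
      obtain i j where ij: "z = (i, j)" by (cases z)
      show "?t z = 0" using *[of i j] z by (auto simp: ij)
    qed
  qed (use fin in \<open>auto simp: S_def\<close>)
  finally have sum0: "sum ?t S = 0" by simp
  show ?thesis
  proof (cases "X = Y")
    case True
    then have "S = {(i0, j0), (j0, i0)}" using e by (auto simp: S_def)
    then have "sum ?t S = 2 * (l i0 * l j0 * ((m i0 - m j0) \<bullet> (v i0 - v j0)))"
      using e(3) k(4)[OF True] by (simp add: inner_diff_left inner_diff_right algebra_simps)
    then show ?thesis using sum0 l(3) e True by auto
  next
    case False
    then have "S = {(i0, j0)}" using e XY by (auto simp: S_def)
    then show ?thesis using sum0 l(3) k(3) e by auto
  qed
qed

section \<open>The pinned framework\<close>

text \<open>The free vertices are \<open>0..3\<close> (left) and \<open>4..8\<close> (right); \<open>{9..<d + 7}\<close> are the left anchors,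
  \<open>{d + 7..<2 * d + 5}\<close> the right anchors. The pairs \<open>(3, 7)\<close>, \<open>(3, 8)\<close> left out below are the two
  dropped edges.\<close>

definition left_verts :: "nat \<Rightarrow> nat set" where
  "left_verts d = {..<4} \<union> {9..<d + 7}"

definition right_verts :: "nat \<Rightarrow> nat set" where
  "right_verts d = {4..<9} \<union> {d + 7..<2 * d + 5}"

definition tight_pairs :: "nat \<Rightarrow> (nat \<times> nat) set" where
  "tight_pairs d = ({..<4} \<times> right_verts d - {(3, 7), (3, 8)}) \<union> {4..<9} \<times> {9..<d + 7}"

lemma finite_tight_pairs: "finite (tight_pairs d)"
  by (auto simp: tight_pairs_def right_verts_def)

lemma card_tight_pairs:
  assumes "d \<ge> 5"
  shows "card (tight_pairs d) = 9 * d"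
proof -
  have "right_verts d = {4..<9} \<union> {d + 7..<2 * d + 5}" by (simp add: right_verts_def)
  moreover have "{4..<9} \<inter> {d + 7..<2 * d + 5} = {}" by auto
  ultimately have "card (right_verts d) = d + 3" using assms by (simp add: card_Un_disjoint)
  then have 1: "card ({..<4 :: nat} \<times> right_verts d) = 4 * (d + 3)" by (simp add: card_cartesian_product)
  have 2: "card ({4..<9 :: nat} \<times> {9..<d + 7}) = 5 * (d - 2)" by (simp add: card_cartesian_product)
  have "{(3, 7), (3, 8)} \<subseteq> {..<4 :: nat} \<times> right_verts d" by (auto simp: right_verts_def)
  then have 3: "card ({..<4 :: nat} \<times> right_verts d - {(3, 7), (3, 8)}) = 4 * (d + 3) - 2"
    by (subst card_Diff_subset) (auto simp: 1)
  show ?thesis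
    unfolding tight_pairs_def
    by (subst card_Un_disjoint) (use 2 3 assms in \<open>auto simp: right_verts_def\<close>)
qed

text \<open>Nonsingularity of the linearized length equations with the body held fixed. By
  \<open>card_tight_pairs\<close> there are as many equations as free coordinates,
  \<open>9 * d\<close>.\<close>

definition pinned_rigid :: "(nat \<Rightarrow> real ^ 'n) \<Rightarrow> bool" where
  "pinned_rigid m \<longleftrightarrow> (\<forall>u :: nat \<Rightarrow> real ^ 'n. (\<forall>i\<ge>9. u i = 0) \<and>
     (\<forall>(i, j)\<in>tight_pairs CARD('n). (m i - m j) \<bullet> (u i - u j) = 0) \<longrightarrow> (\<forall>i. u i = 0))"

lemma bij_betw_free_verts: obtains h :: "nat \<Rightarrow> 9" where "bij_betw h {..<9} UNIV"
  using finite_same_card_bij[of "{..<9::nat}" "UNIV :: 9 set"] by auto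

lemma tight_pairs_verts:
  "(i, j) \<in> tight_pairs d \<Longrightarrow> i < 9 \<and> j < 2 * d + 5 \<and> i \<noteq> j \<and> i < 2 * d + 5" if "d \<ge> 5"
  using that by (auto simp: tight_pairs_def right_verts_def)

text \<open>The nine free velocities are packed into one vector indexed by
  \<open>9 \<times> 'n\<close>, with \<open>dec\<close> as unpacking map, which turns the condition
  into injectivity of a finite linear system.\<close>

lemma zariski_open_pinned_rigid:
  assumes d: "CARD('n) \<ge> 5" and V: "{..<2 * CARD('n) + 5} \<subseteq> V"
  shows "zariski_open V (pinned_rigid :: (nat \<Rightarrow> real ^ 'n) \<Rightarrow> bool)"
proof -
  obtain h :: "nat \<Rightarrow> 9" where h: "bij_betw h {..<9} UNIV" by (rule bij_betw_free_verts)
  define \<delta> where "\<delta> = (\<lambda>i c. if i < 9 \<and> c = h i then 1 else 0 :: real)"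
  define r where "r = (\<lambda>(i, j) (m :: nat \<Rightarrow> real ^ 'n). \<chi> l :: 9 \<times> 'n.
     (m i $ snd l - m j $ snd l) * (\<delta> i (fst l) - \<delta> j (fst l)))"
  define dec where "dec = (\<lambda>(u :: real ^ (9 \<times> 'n)) i. if i < 9 then \<chi> k. u $ (h i, k) else 0)"
  have sum\<delta>: "(\<Sum>c\<in>UNIV. \<delta> i c * u $ (c, k)) = dec u i $ k" for i k u
    by (auto simp: \<delta>_def dec_def if_distrib[of "\<lambda>x. x * _"] sum.delta cong: if_cong)
  have r_inner: "r (i, j) m \<bullet> u = (m i - m j) \<bullet> (dec u i - dec u j)" for i j m u
  proof -
    have "r (i, j) m \<bullet> u = (\<Sum>c\<in>UNIV. \<Sum>k\<in>UNIV. (m i $ k - m j $ k) * (\<delta> i c - \<delta> j c) * u $ (c, k))"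
      unfolding inner_vec_def r_def
      by (simp add: sum.cartesian_product UNIV_Times_UNIV[symmetric] case_prod_beta del: UNIV_Times_UNIV)
    also have "\<dots> = (\<Sum>k\<in>UNIV. (m i $ k - m j $ k) * (\<Sum>c\<in>UNIV. (\<delta> i c - \<delta> j c) * u $ (c, k)))"
      by (subst sum.swap) (simp add: sum_distrib_left mult.assoc)
    also have "\<dots> = (m i - m j) \<bullet> (dec u i - dec u j)"
      by (simp add: inner_vec_def left_diff_distrib sum_subtractf sum\<delta>)
    finally show ?thesis .
  qed
  have "zariski_open V (\<lambda>m :: nat \<Rightarrow> real ^ 'n. \<forall>u. (\<forall>e\<in>tight_pairs CARD('n). r e m \<bullet> u = 0) \<longrightarrow> u = 0)"
  proof (rule zariski_open_linear_system[OF finite_tight_pairs])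
    fix e and l :: "9 \<times> 'n" assume e: "e \<in> tight_pairs CARD('n)"
    obtain i j where ij: "e = (i, j)" by (cases e)
    have "i \<in> V" "j \<in> V" using e V tight_pairs_verts[OF d] by (auto simp: ij)
    moreover have "rat_polyfun (V \<times> UNIV) (\<lambda>x :: nat \<times> 'n \<Rightarrow> real. \<delta> i c - \<delta> j c)" for c
      by (auto simp: \<delta>_def intro: rat_polyfun_0 rat_polyfun_1 rat_polyfun_diff rat_polyfun_uminus)
    ultimately have "rat_polyfun (V \<times> UNIV) (\<lambda>x. (x (i, snd l) - x (j, snd l)) * (\<delta> i (fst l) - \<delta> j (fst l)))"
      by (intro rat_polyfun_mult rat_polyfun_diff[of _ "\<lambda>x. x (i, snd l)"] rat_polyfun_var) auto
    then show "\<exists>F. rat_polyfun (V \<times> UNIV) F \<and> (\<forall>m. r e m $ l = F (\<lambda>(i, k). m i $ k))"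
      by (intro exI conjI, assumption) (simp add: r_def ij)
  qed
  moreover have "(\<forall>u. (\<forall>e\<in>tight_pairs CARD('n). r e m \<bullet> u = 0) \<longrightarrow> u = 0) \<longleftrightarrow> pinned_rigid m"
    for m :: "nat \<Rightarrow> real ^ 'n"
  proof
    assume *: "\<forall>u. (\<forall>e\<in>tight_pairs CARD('n). r e m \<bullet> u = 0) \<longrightarrow> u = 0"
    show "pinned_rigid m"
      unfolding pinned_rigid_def
    proof (intro allI impI, elim conjE)
      fix u :: "nat \<Rightarrow> real ^ 'n" and i
      assume u: "\<forall>i\<ge>9. u i = 0"
        "\<forall>(i, j)\<in>tight_pairs CARD('n). (m i - m j) \<bullet> (u i - u j) = 0"
      define U :: "real ^ (9 \<times> 'n)" where "U = (\<chi> l. u (inv_into {..<9} h (fst l)) $ snd l)"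
      have "dec U = u"
        using u(1) by (auto simp: fun_eq_iff dec_def U_def vec_eq_iff bij_betw_inv_into_left[OF h])
      then have "\<forall>e\<in>tight_pairs CARD('n). r e m \<bullet> U = 0"
        using u(2) by (auto simp: r_inner)
      with * have "U = 0" by blast
      with \<open>dec U = u\<close> show "u i = 0" by (auto simp: dec_def vec_eq_iff)
    qed
  next
    assume *: "pinned_rigid m"
    show "\<forall>u. (\<forall>e\<in>tight_pairs CARD('n). r e m \<bullet> u = 0) \<longrightarrow> u = 0"
    proof (intro allI impI)
      fix u assume "\<forall>e\<in>tight_pairs CARD('n). r e m \<bullet> u = 0"
      then have "\<forall>(i, j)\<in>tight_pairs CARD('n). (m i - m j) \<bullet> (dec u i - dec u j) = 0"
        by (auto simp: r_inner)
      moreover have "\<forall>i\<ge>9. dec u i = 0" by (simp add: dec_def)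
      ultimately have 0: "dec u i = 0" for i
        using * unfolding pinned_rigid_def by blast
      have "u $ (c, k) = 0" for c k
      proof -
        obtain i where "i < 9" "c = h i" using h by (auto simp: bij_betw_def image_iff)
        then show ?thesis using 0[of i] by (simp add: dec_def vec_eq_iff)
      qed
      then show "u = 0" by (auto simp: vec_eq_iff)
    qed
  qed
  ultimately show ?thesis by (simp add: fun_eq_iff)
qed

section \<open>An explicit nonsingular configuration with coplanar anchors\<close>

text \<open>Coordinates of a configuration in which both sets of anchors lie in the hyperplane where
  coordinate 2 vanishes.\<close>

definition base_coord :: "nat \<Rightarrow> nat \<Rightarrow> nat \<Rightarrow> real" where
  "base_coord d i k =
    (if i < 9 then if k < 5 then
        [[1, 0, 0, 0, 0], [0, 1, 0, 0, 0], [0, 0, 1, 0, 0], [0, 1, 1, 1, - 1],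
         [0, 1, 0, 1, - 1], [1, 0, 0, - 1, 1], [1, 0, 1, - 1, 0], [0, 0, 1, 0, 1], [0, 0, 1, 1, 0]] ! i ! k
      else 0
     else if i < d + 7 then if i \<noteq> 9 \<and> k + 7 = i then 1 else 0
     else if i < 2 * d + 5 then
       if i \<noteq> d + 7 \<and> k + (d + 5) = i then 1
       else if i = d + 8 \<and> k = 0 \<or> i = d + 9 \<and> k = 1 then - 1 else 0
     else if i = 2 * d + 5 \<and> k = 2 then 1 else 0)"

text \<open>\<open>\<kappa>\<close> numbers the coordinates, since the explicit configuration refers
  to the axes 0 to 4 by number while \<open>'n\<close> is an arbitrary finite type.\<close>

locale coordinates =
  fixes \<kappa> :: "nat \<Rightarrow> 'n::finite"
  assumes bij: "bij_betw \<kappa> {..<CARD('n)} UNIV" and dim: "CARD('n) \<ge> 5"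
begin

definition base :: "nat \<Rightarrow> real ^ 'n" where
  "base i = (\<chi> c. base_coord CARD('n) i (the_inv_into {..<CARD('n)} \<kappa> c))"

lemma base_nth: "k < CARD('n) \<Longrightarrow> base i $ \<kappa> k = base_coord CARD('n) i k"
  using bij by (simp add: base_def bij_betw_def the_inv_into_f_f)

lemma inner_coords: "x \<bullet> y = (\<Sum>k<CARD('n). x $ \<kappa> k * y $ \<kappa> k)" for x y :: "real ^ 'n"
  unfolding inner_vec_def by (simp add: sum.reindex_bij_betw[OF bij, symmetric])

lemma vec_eq_coords: "x = y \<longleftrightarrow> (\<forall>k<CARD('n). x $ \<kappa> k = y $ \<kappa> k)" for x y :: "real ^ 'n"
  unfolding vec_eq_iff using bij by (metis UNIV_I bij_betw_def image_iff lessThan_iff)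

lemma inner_base_free:
  assumes "i < 9"
  shows "base i \<bullet> x = (\<Sum>k<5. base_coord CARD('n) i k * x $ \<kappa> k)"
proof -
  have "base i \<bullet> x = (\<Sum>k<CARD('n). base_coord CARD('n) i k * x $ \<kappa> k)"
    by (simp add: inner_coords base_nth)
  also have "\<dots> = (\<Sum>k<5. base_coord CARD('n) i k * x $ \<kappa> k)"
    by (rule sum.mono_neutral_right) (use dim assms in \<open>auto simp: base_coord_def\<close>)
  finally show ?thesis .
qed

lemma inner_axis_coord: "axis (\<kappa> k) 1 \<bullet> x = x $ \<kappa> k" for x :: "real ^ 'n"
  by (simp add: inner_axis inner_commute[of "axis _ _"])

lemma kappa_inj: "k < CARD('n) \<Longrightarrow> l < CARD('n) \<Longrightarrow> \<kappa> k = \<kappa> l \<longleftrightarrow> k = l"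
  using bij by (auto simp: bij_betw_def inj_on_def)

lemma base_left_anchor:
  assumes "2 \<le> s" "s < CARD('n)"
  shows "base (s + 7) = (if s = 2 then 0 else axis (\<kappa> s) 1)"
  using assms by (auto simp: vec_eq_coords base_nth base_coord_def axis_def kappa_inj)

lemma base_right_anchor:
  assumes "2 \<le> s" "s < CARD('n)"
  shows "base (s + (CARD('n) + 5)) = (if s = 2 then 0 else axis (\<kappa> s) 1 -
    (if s = 3 then axis (\<kappa> 0) 1 else if s = 4 then axis (\<kappa> 1) 1 else 0))"
proof -
  have "\<kappa> k = \<kappa> 0 \<longleftrightarrow> k = 0" "\<kappa> k = \<kappa> 1 \<longleftrightarrow> k = 1" if "k < CARD('n)" for k
    using that dim by (auto simp: kappa_inj)
  then show ?thesis
    using assms by (auto simp: vec_eq_coords base_nth base_coord_def axis_def kappa_inj)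
qed

text \<open>Write \<open>e k\<close> for the unit vector of coordinate \<open>k\<close>. The left
  anchors are the origin and \<open>e 3, e 4, e 5, ...\<close>; the right anchors are the origin,
  \<open>e 3 - e 0\<close>, \<open>e 4 - e 1\<close> and \<open>e 5, ...\<close>. The equations
  towards the anchors thus reduce each free velocity to its coordinates 0, 1, 2. The small integers
  chosen for the free vertices make the remaining 27 equations nonsingular.\<close>

lemma pinned_rigid_base: "pinned_rigid base"
  unfolding pinned_rigid_def
proof (intro allI impI, elim conjE)
  fix u :: "nat \<Rightarrow> real ^ 'n" and i
  assume u0: "\<forall>i\<ge>9. u i = 0"
    and eq: "\<forall>(i, j)\<in>tight_pairs CARD('n). (base i - base j) \<bullet> (u i - u j) = 0"
  define U where "U = (\<lambda>i k. u i $ \<kappa> k)"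
  have right: "(base i - base (s + (CARD('n) + 5))) \<bullet> u i = 0"
    if "i < 4" "2 \<le> s" "s < CARD('n)" for i s
  proof -
    have "(i, s + (CARD('n) + 5)) \<in> tight_pairs CARD('n)"
      using that dim by (auto simp: tight_pairs_def right_verts_def)
    with eq have "(base i - base (s + (CARD('n) + 5))) \<bullet> (u i - u (s + (CARD('n) + 5))) = 0" by blast
    moreover have "u (s + (CARD('n) + 5)) = 0" using u0 dim by simp
    ultimately show ?thesis by simp
  qed
  have left: "(base j - base (s + 7)) \<bullet> u j = 0"
    if "4 \<le> j" "j < 9" "2 \<le> s" "s < CARD('n)" for j s
  proof -
    have "(j, s + 7) \<in> tight_pairs CARD('n)"
      using that dim by (auto simp: tight_pairs_def)
    with eq have "(base j - base (s + 7)) \<bullet> (u j - u (s + 7)) = 0" by blast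
    moreover have "u (s + 7) = 0" using u0 that by simp
    ultimately show ?thesis by simp
  qed
  \<comment> \<open>The anchor with \<open>s = 2\<close> sits at the origin; its equation,
    subtracted from the others, removes the position of the free vertex from them.\<close>
  have n: "base i \<bullet> u i = 0" if "i < 9" for i
    using right[of i 2] left[of i 2] that dim base_right_anchor[of 2] base_left_anchor[of 2]
    by (cases "i < 4") simp_all
  have ra: "base (s + (CARD('n) + 5)) \<bullet> u i = 0" if "i < 4" "2 \<le> s" "s < CARD('n)" for i s
    using right[OF that] n[of i] that by (simp add: inner_diff_left)
  have la: "base (s + 7) \<bullet> u j = 0" if "4 \<le> j" "j < 9" "2 \<le> s" "s < CARD('n)" for j s
    using left[OF that] n[of j] that by (simp add: inner_diff_left)
  have U_right: "U j s = 0" if "4 \<le> j" "j < 9" "3 \<le> s" "s < CARD('n)" for j s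
    using la[of j s] that base_left_anchor[of s] by (auto simp: inner_axis_coord U_def)
  have U_left: "U i 3 = U i 0" "U i 4 = U i 1" "5 \<le> s \<Longrightarrow> s < CARD('n) \<Longrightarrow> U i s = 0" if "i < 4" for i s
    using ra[OF that, of 3] ra[OF that, of 4] ra[OF that, of s] dim
      base_right_anchor[of 3] base_right_anchor[of 4] base_right_anchor[of s]
    by (auto simp: inner_axis_coord U_def inner_diff_left)
  \<comment> \<open>The diagonal terms vanish by \<open>n\<close>, so only the mixed terms of a
    bipartite equation remain. The last condition excludes the dropped pairs \<open>(3, 7)\<close>
    and \<open>(3, 8)\<close>.\<close>
  have pair: "base i \<bullet> u j + base j \<bullet> u i = 0"
    if "i < 4" "4 \<le> j" "j < 9" "i < 3 \<or> j < 7" for i j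
  proof -
    have "(i, j) \<in> tight_pairs CARD('n)"
      using that by (auto simp: tight_pairs_def right_verts_def)
    with eq have "(base i - base j) \<bullet> (u i - u j) = 0" by auto
    then show ?thesis using n[of i] n[of j] that
      by (simp add: inner_diff_left inner_diff_right)
  qed
  have 5: "(\<Sum>k<5. f k) = f 0 + f 1 + f 2 + f 3 + f 4" for f :: "nat \<Rightarrow> real"
    by (simp add: eval_nat_numeral)
  have "base i \<bullet> u j = (\<Sum>k<5. base_coord CARD('n) i k * U j k)" if "i < 9" for i j
    using that by (simp add: inner_base_free U_def)
  note ev = this 5 base_coord_def
  have E: "base 0 \<bullet> u j = U j 0"
    "base 1 \<bullet> u j = U j 1"
    "base 2 \<bullet> u j = U j 2"
    "base 3 \<bullet> u j = U j 1 + U j 2 + U j 3 - U j 4"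
    "base 4 \<bullet> u j = U j 1 + U j 3 - U j 4"
    "base 5 \<bullet> u j = U j 0 - U j 3 + U j 4"
    "base 6 \<bullet> u j = U j 0 + U j 2 - U j 3"
    "base 7 \<bullet> u j = U j 2 + U j 4"
    "base 8 \<bullet> u j = U j 2 + U j 3" for j
    by (simp_all add: ev)
  have Q: "base 0 \<bullet> u 4 + base 4 \<bullet> u 0 = 0"
    "base 0 \<bullet> u 5 + base 5 \<bullet> u 0 = 0"
    "base 0 \<bullet> u 6 + base 6 \<bullet> u 0 = 0"
    "base 0 \<bullet> u 7 + base 7 \<bullet> u 0 = 0"
    "base 0 \<bullet> u 8 + base 8 \<bullet> u 0 = 0"
    "base 1 \<bullet> u 4 + base 4 \<bullet> u 1 = 0"
    "base 1 \<bullet> u 5 + base 5 \<bullet> u 1 = 0"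
    "base 1 \<bullet> u 6 + base 6 \<bullet> u 1 = 0"
    "base 1 \<bullet> u 7 + base 7 \<bullet> u 1 = 0"
    "base 1 \<bullet> u 8 + base 8 \<bullet> u 1 = 0"
    "base 2 \<bullet> u 4 + base 4 \<bullet> u 2 = 0"
    "base 2 \<bullet> u 5 + base 5 \<bullet> u 2 = 0"
    "base 2 \<bullet> u 6 + base 6 \<bullet> u 2 = 0"
    "base 2 \<bullet> u 7 + base 7 \<bullet> u 2 = 0"
    "base 2 \<bullet> u 8 + base 8 \<bullet> u 2 = 0"
    "base 3 \<bullet> u 4 + base 4 \<bullet> u 3 = 0"
    "base 3 \<bullet> u 5 + base 5 \<bullet> u 3 = 0"
    "base 3 \<bullet> u 6 + base 6 \<bullet> u 3 = 0"
    by (rule pair; simp)+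
  have N: "base 0 \<bullet> u 0 = 0"
    "base 1 \<bullet> u 1 = 0"
    "base 2 \<bullet> u 2 = 0"
    "base 3 \<bullet> u 3 = 0"
    "base 4 \<bullet> u 4 = 0"
    "base 5 \<bullet> u 5 = 0"
    "base 6 \<bullet> u 6 = 0"
    "base 7 \<bullet> u 7 = 0"
    "base 8 \<bullet> u 8 = 0"
    by (rule n; simp)+
  have UL: "U 0 3 = U 0 0" "U 0 4 = U 0 1"
    "U 1 3 = U 1 0" "U 1 4 = U 1 1"
    "U 2 3 = U 2 0" "U 2 4 = U 2 1"
    "U 3 3 = U 3 0" "U 3 4 = U 3 1"
    by (simp_all add: U_left)
  have UR: "U 4 3 = 0" "U 4 4 = 0"
    "U 5 3 = 0" "U 5 4 = 0"
    "U 6 3 = 0" "U 6 4 = 0"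
    "U 7 3 = 0" "U 7 4 = 0"
    "U 8 3 = 0" "U 8 4 = 0"
    using dim by (simp_all add: U_right)
  note eqs = Q[unfolded E UL UR] N[unfolded E UL UR]
  have zero: "U i k = 0" if "i < 9" "k < 3" for i k
  proof -
    \<comment> \<open>The 18 equations \<open>Q\<close> and the nine equations \<open>N\<close>,
      after substitution, against 27 unknowns.\<close>
    have "U 0 0 = 0 \<and> U 0 1 = 0 \<and> U 0 2 = 0 \<and> U 1 0 = 0 \<and> U 1 1 = 0 \<and> U 1 2 = 0 \<and> U 2 0 = 0 \<and> U 2 1 = 0 \<and> U 2 2 = 0 \<and> U 3 0 = 0 \<and> U 3 1 = 0 \<and> U 3 2 = 0 \<and> U 4 0 = 0 \<and> U 4 1 = 0 \<and> U 4 2 = 0 \<and> U 5 0 = 0 \<and> U 5 1 = 0 \<and> U 5 2 = 0 \<and> U 6 0 = 0 \<and> U 6 1 = 0 \<and> U 6 2 = 0 \<and> U 7 0 = 0 \<and> U 7 1 = 0 \<and> U 7 2 = 0 \<and> U 8 0 = 0 \<and> U 8 1 = 0 \<and> U 8 2 = 0"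
      by (intro conjI; use eqs in linarith)
    then have "\<forall>i\<in>{0, 1, 2, 3, 4, 5, 6, 7, 8}. \<forall>k\<in>{0, 1, 2}. U i k = 0" by simp
    moreover have "i \<in> {0, 1, 2, 3, 4, 5, 6, 7, 8}" "k \<in> {0, 1, 2}" using that by auto
    ultimately show ?thesis by blast
  qed
  have "U i k = 0" if "i < 9" "k < CARD('n)" for i k
  proof (cases "k < 3")
    case False
    then consider "k = 3" | "k = 4" | "5 \<le> k" by linarith
    then show ?thesis
      using that False U_right[of i k] U_left(1,2)[of i] U_left(3)[of i k] zero[of i 0] zero[of i 1]
      by cases (cases "i < 4"; simp)+
  qed (use zero that in blast)
  then show "u i = 0"
    using u0 by (cases "i < 9") (auto simp: vec_eq_coords U_def)
qed

end

section \<open>The graphs\<close>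

text \<open>Edges between left and right anchors belong to both families. The bipartite family is
  listed in full so that the product stress can be applied to it as a complete bipartite
  graph.\<close>

definition body_bipartite_graph :: "nat \<Rightarrow> nat \<Rightarrow> nat graph" where
  "body_bipartite_graph d n = ({..<n},
     {{i, j} | i j. i \<in> left_verts d \<and> j \<in> right_verts d} \<union>
     {{i, j} | i j. i \<in> {9..<n} \<and> j \<in> {9..<n} \<and> i \<noteq> j})"

lemma verts_body_bipartite [simp]: "verts (body_bipartite_graph d n) = {..<n}"
  by (simp add: body_bipartite_graph_def)

lemma body_bipartite_edgesI:
  "i \<in> left_verts d \<Longrightarrow> j \<in> right_verts d \<Longrightarrow> {i, j} \<in> edges (body_bipartite_graph d n)"
  "i \<in> {9..<n} \<Longrightarrow> j \<in> {9..<n} \<Longrightarrow> i \<noteq> j \<Longrightarrow> {i, j} \<in> edges (body_bipartite_graph d n)"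
  by (auto simp: body_bipartite_graph_def)

lemma body_bipartite_edgesE:
  assumes "{i, j} \<in> edges (body_bipartite_graph d n)"
  obtains k l where "{i, j} = {k, l}" "k \<in> left_verts d" "l \<in> right_verts d"
  | k l where "{i, j} = {k, l}" "k \<in> {9..<n}" "l \<in> {9..<n}" "k \<noteq> l"
  using assms unfolding body_bipartite_graph_def by auto

lemma left_right_disjoint: "left_verts d \<inter> right_verts d = {}"
  by (auto simp: left_verts_def right_verts_def)

lemma card_left_verts: "d \<ge> 5 \<Longrightarrow> card (left_verts d) = d + 2"
  unfolding left_verts_def by (subst card_Un_disjoint) auto

lemma card_right_verts: "d \<ge> 5 \<Longrightarrow> card (right_verts d) = d + 3"
  unfolding right_verts_def by (subst card_Un_disjoint) auto

lemma left_right_verts_subset: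
  "n \<ge> 2 * d + 5 \<Longrightarrow> d \<ge> 5 \<Longrightarrow> left_verts d \<subseteq> {..<n}"
  "n \<ge> 2 * d + 5 \<Longrightarrow> d \<ge> 5 \<Longrightarrow> right_verts d \<subseteq> {..<n}"
  by (auto simp: left_verts_def right_verts_def)

lemma finite_simple_body_bipartite:
  assumes "d \<ge> 5" "n \<ge> 2 * d + 5"
  shows "finite_simple_graph (body_bipartite_graph d n)"
proof -
  have "e \<subseteq> {..<n} \<and> card e = 2" if e: "e \<in> edges (body_bipartite_graph d n)" for e
  proof -
    consider k l where "e = {k, l}" "k \<in> left_verts d" "l \<in> right_verts d"
      | k l where "e = {k, l}" "k \<in> {9..<n}" "l \<in> {9..<n}" "k \<noteq> l"
      using e unfolding body_bipartite_graph_def snd_conv by blast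
    then show ?thesis
    proof cases
      case 1
      then show ?thesis
        using left_right_verts_subset[OF assms(2,1)] left_right_disjoint[of d]
        by (cases "k = l") auto
    qed auto
  qed
  then show ?thesis by (simp add: finite_simple_graph_def)
qed

lemma tight_pairs_edges:
  assumes "d \<ge> 5" "(i, j) \<in> tight_pairs d"
  shows "{i, j} \<in> edges (body_bipartite_graph d n)"
proof -
  have "i \<in> left_verts d \<and> j \<in> right_verts d \<or> j \<in> left_verts d \<and> i \<in> right_verts d"
    using assms by (auto simp: tight_pairs_def left_verts_def right_verts_def)
  then show ?thesis using body_bipartite_edgesI(1) by (metis insert_commute)
qed

text \<open>Once the condition on the deleted edge is recovered from the stress, \<open>v\<close>
  acts on the body as an infinitesimal motion \<open>A x + t\<close>. Subtracting that motion leaves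
  a flex vanishing on the body, which \<open>pinned_rigid\<close> excludes.\<close>

lemma infinitesimally_rigid_delete_edge:
  fixes m :: "nat \<Rightarrow> real ^ 'n"
  assumes d: "CARD('n) \<ge> 5" and n: "n \<ge> 2 * CARD('n) + 6"
    and gp: "general_position {..<n} m" and pin: "pinned_rigid m"
  shows "infinitesimally_rigid (delete_edge (body_bipartite_graph CARD('n) n) e) m"
  unfolding infinitesimally_rigid_def
proof (intro allI impI)
  let ?d = "CARD('n)" and ?E = "edges (body_bipartite_graph CARD('n) n)"
  fix v assume v: "infinitesimal_flex (edges (delete_edge (body_bipartite_graph ?d n) e)) m v"
  have flex_ne: "(m i - m j) \<bullet> (v i - v j) = 0" if "{i, j} \<in> ?E" "{i, j} \<noteq> e" for i j
    using v that by (simp add: infinitesimal_flex_def delete_edge_def)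
  have swap: "(m i - m j) \<bullet> (v i - v j) = (m k - m l) \<bullet> (v k - v l)" if "{i, j} = {k, l}" for i j k l
    using that by (auto simp: doubleton_eq_iff inner_diff_left inner_diff_right)
  have flex: "(m i - m j) \<bullet> (v i - v j) = 0" if "{i, j} \<in> ?E" for i j
  proof (cases "{i, j} = e")
    case True
    from that show ?thesis
    proof (cases rule: body_bipartite_edgesE)
      case (1 k l)
      \<comment> \<open>The right side has \<open>d + 3\<close> vertices, one more than an affine
        dependency without zero coefficients allows; any vertex other than the end \<open>l\<close>
        of the deleted edge may be left out.\<close>
      obtain r where r: "r \<in> right_verts ?d" "r \<noteq> l"
        by (rule that[of "if l = 4 then 5 else 4"]) (auto simp: right_verts_def)
      have "(m k - m l) \<bullet> (v k - v l) = 0"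
      proof (rule flex_across_missing_edge[OF gp])
        show "left_verts ?d \<subseteq> {..<n}" "right_verts ?d - {r} \<subseteq> {..<n}"
          using left_right_verts_subset[of "CARD('n)" n] n d by auto
        show "card (left_verts ?d) = ?d + 2" by (rule card_left_verts[OF d])
        show "card (right_verts ?d - {r}) = ?d + 2"
          using r card_right_verts[OF d] by (simp add: right_verts_def)
        show "left_verts ?d = right_verts ?d - {r} \<or> left_verts ?d \<inter> (right_verts ?d - {r}) = {}"
          using left_right_disjoint by blast
        show "k \<in> left_verts ?d" "l \<in> right_verts ?d - {r}" using 1 r by auto
        show "k \<noteq> l" using 1 left_right_disjoint by auto
        fix i' j' assume "i' \<in> left_verts ?d" "j' \<in> right_verts ?d - {r}" "{i', j'} \<noteq> {k, l}"
        then show "(m i' - m j') \<bullet> (v i' - v j') = 0"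
          using True 1(1) by (intro flex_ne body_bipartite_edgesI(1)) auto
      qed
      then show ?thesis using swap[OF 1(1)] by simp
    next
      case (2 k l)
      \<comment> \<open>The body has at least \<open>2 * d - 3\<close> vertices, which is at least
        \<open>d + 2\<close> because \<open>d >= 5\<close>.\<close>
      have "card ({9..<n} - {k, l}) \<ge> ?d" using d n 2 by (subst card_Diff_subset) auto
      then obtain T where T: "T \<subseteq> {9..<n} - {k, l}" "card T = ?d"
        by (meson obtain_subset_with_card_n)
      then have fT: "finite T" by (metis finite_Diff finite_atLeastLessThan finite_subset)
      let ?X = "insert k (insert l T)"
      have "k \<notin> T" "l \<notin> T" using T(1) by auto
      then have cX: "card ?X = ?d + 2" using T(2) fT 2(4) by simp
      have e: "e = {k, l}" using True 2(1) by simp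
      have sub: "?X \<subseteq> {9..<n}" using T(1) 2(2,3) by blast
      then have sub': "?X \<subseteq> {..<n}" by (rule order.trans) auto
      have "(m k - m l) \<bullet> (v k - v l) = 0"
      proof (rule flex_across_missing_edge[OF gp sub' cX sub' cX])
        fix i' j' assume "i' \<in> ?X" "j' \<in> ?X" "i' \<noteq> j'" "{i', j'} \<noteq> {k, l}"
        then show "(m i' - m j') \<bullet> (v i' - v j') = 0"
          using sub by (intro flex_ne body_bipartite_edgesI(2)) (blast, blast, blast, simp add: e)
      qed (use 2(4) in auto)
      then show ?thesis using swap[OF 2(1)] by simp
    qed
  qed (use flex_ne that in blast)
  let ?X = "{9..<?d + 10}"
  have "affinely_indep ?X m"
    using gp[unfolded general_position_def, rule_format, of ?X] d n by (simp add: subset_iff)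
  moreover have "card ?X = ?d + 1" by simp
  moreover have "?X \<subseteq> {9..<n}" using d n by auto
  moreover have "(m i - m j) \<bullet> (v i - v j) = 0" if "i \<in> {9..<n}" "j \<in> {9..<n}" for i j
    using flex body_bipartite_edgesI(2) that by (cases "i = j") auto
  ultimately obtain A t where A: "linear A" "\<And>x. x \<bullet> A x = 0"
    and vA: "\<And>i. i \<in> {9..<n} \<Longrightarrow> v i = A (m i) + t"
    using infinitesimal_motion_extension by blast
  define u where "u = (\<lambda>i. if i < n then v i - (A (m i) + t) else 0)"
  have "\<forall>i\<ge>9. u i = 0" using vA by (simp add: u_def)
  moreover have "(m i - m j) \<bullet> (u i - u j) = 0" if ij: "(i, j) \<in> tight_pairs ?d" for i j
  proof -
    have "i < n" "j < n" using tight_pairs_verts[OF d ij] n by auto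
    then have "u i - u j = (v i - v j) - A (m i - m j)"
      by (simp add: u_def linear_diff[OF A(1)])
    then show ?thesis
      using flex[OF tight_pairs_edges[OF d ij]] A(2)[of "m i - m j"] by (simp add: inner_diff_right)
  qed
  ultimately have "u i = 0" for i using pin unfolding pinned_rigid_def by blast
  then have "v i = A (m i) + t" if "i < n" for i
    using that by (simp add: u_def) (metis eq_iff_diff_eq_0)
  then have "v i - v j = A (m i - m j)" if "i < n" "j < n" for i j
    using that by (simp add: linear_diff[OF A(1)])
  then show "\<forall>i\<in>verts (delete_edge (body_bipartite_graph ?d n) e).
     \<forall>j\<in>verts (delete_edge (body_bipartite_graph ?d n) e). (m i - m j) \<bullet> (v i - v j) = 0"
    using A(2) by (simp add: delete_edge_def)
qed

text \<open>The surviving body is complete, and each surviving free vertex reaches it directly or by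
  a detour: if all anchors adjacent to it are deleted, an anchor of its own side survives, since
  \<open>2 * (d - 2) > d\<close>, and so does a vertex of the opposite side, which is adjacent to
  both.\<close>

lemma vertex_connected_body_bipartite:
  assumes d: "d \<ge> 5" and n: "n \<ge> 2 * d + 5"
  shows "vertex_connected (d + 1) (body_bipartite_graph d n)"
  unfolding vertex_connected_def
proof (intro conjI allI impI)
  show "d + 1 + 1 \<le> card (verts (body_bipartite_graph d n))" using d n by simp
  fix S assume S: "S \<subseteq> verts (body_bipartite_graph d n) \<and> card S < d + 1"
  then have cS: "card S < d + 1" and "S \<subseteq> {..<n}" by auto
  then have fS: "finite S" using finite_subset by auto
  let ?G = "delete_verts (body_bipartite_graph d n) S"
  let ?R = "{(x, y). {x, y} \<in> edges ?G}"
  have escape: "\<exists>x\<in>A. x \<notin> S" if "card A > d" for A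
  proof (rule ccontr)
    assume "\<not> ?thesis"
    then have "A \<subseteq> S" by blast
    then show False using card_mono[OF fS, of A] that cS by simp
  qed
  have escape2: "(\<exists>x\<in>A. x \<notin> S) \<or> (\<exists>x\<in>B. x \<notin> S)"
    if "card A + card B > d" "A \<inter> B = {}" "finite A" "finite B" for A B
    using escape[of "A \<union> B"] that by (auto simp: card_Un_disjoint)
  have step: "(x, y) \<in> ?R\<^sup>*" if "{x, y} \<in> edges (body_bipartite_graph d n)" "x \<notin> S" "y \<notin> S" for x y
    using that by (intro r_into_rtrancl) (auto simp: delete_verts_def)
  obtain h where h: "h \<in> {9..<n}" "h \<notin> S"
  proof -
    have "card {9..<n} > d" using d n by simp
    from escape[OF this] show thesis using that by blast
  qed
  have body: "(x, h) \<in> ?R\<^sup>*" if "x \<in> {9..<n}" "x \<notin> S" for x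
    using step[OF body_bipartite_edgesI(2)] that h by (cases "x = h") auto
  have left: "(x, h) \<in> ?R\<^sup>*" if "x \<in> {9..<d + 7}" "x \<notin> S" for x
    using body that d n by auto
  have right: "(x, h) \<in> ?R\<^sup>*" if "x \<in> {d + 7..<2 * d + 5}" "x \<notin> S" for x
    using body that d n by auto
  have bip: "(x, y) \<in> ?R\<^sup>*" "(y, x) \<in> ?R\<^sup>*"
    if "x \<in> left_verts d" "y \<in> right_verts d" "x \<notin> S" "y \<notin> S" for x y
    using step[OF body_bipartite_edgesI(1)[OF that(1,2)]] step[of y x] that
      body_bipartite_edgesI(1)[OF that(1,2), of n] by (auto simp: insert_commute)
  have anchors: "(\<exists>x\<in>{9..<d + 7}. x \<notin> S) \<or> (\<exists>x\<in>{d + 7..<2 * d + 5}. x \<notin> S)"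
    using d by (intro escape2) auto
  have to_h: "(x, h) \<in> ?R\<^sup>*" if x: "x < n" "x \<notin> S" for x
  proof -
    consider "x < 4" | "4 \<le> x" "x < 9" | "9 \<le> x" by linarith
    then show ?thesis
    proof cases
      case 1
      then have xl: "x \<in> left_verts d" by (simp add: left_verts_def)
      show ?thesis
      proof (cases "\<exists>y\<in>{d + 7..<2 * d + 5}. y \<notin> S")
        case True
        then obtain y where y: "y \<in> {d + 7..<2 * d + 5}" "y \<notin> S" by blast
        then have "y \<in> right_verts d" by (simp add: right_verts_def)
        then show ?thesis using bip(1)[OF xl] y x right by (meson rtrancl_trans)
      next
        case False
        with anchors obtain z where z: "z \<in> {9..<d + 7}" "z \<notin> S" by blast
        have "(\<exists>y\<in>{4..<9}. y \<notin> S) \<or> (\<exists>y\<in>{d + 7..<2 * d + 5}. y \<notin> S)"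
          using d by (intro escape2) auto
        then obtain y where "y \<in> {4..<9} \<union> {d + 7..<2 * d + 5}" "y \<notin> S" by blast
        then have y: "y \<in> right_verts d" "y \<notin> S" by (auto simp: right_verts_def)
        have "z \<in> left_verts d" using z by (simp add: left_verts_def)
        then show ?thesis using bip(1)[OF xl y(1)] bip(2)[of z y] y z x left by (meson rtrancl_trans)
      qed
    next
      case 2
      then have xr: "x \<in> right_verts d" by (simp add: right_verts_def)
      show ?thesis
      proof (cases "\<exists>y\<in>{9..<d + 7}. y \<notin> S")
        case True
        then obtain y where y: "y \<in> {9..<d + 7}" "y \<notin> S" by blast
        then have "y \<in> left_verts d" by (simp add: left_verts_def)
        then show ?thesis using bip(2)[OF _ xr] y x left by (meson rtrancl_trans)
      next
        case False
        with anchors obtain z where z: "z \<in> {d + 7..<2 * d + 5}" "z \<notin> S" by blast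
        have "(\<exists>y\<in>{..<4}. y \<notin> S) \<or> (\<exists>y\<in>{9..<d + 7}. y \<notin> S)"
          using d by (intro escape2) auto
        then obtain y where "y \<in> {..<4} \<union> {9..<d + 7}" "y \<notin> S" by blast
        then have y: "y \<in> left_verts d" "y \<notin> S" by (auto simp: left_verts_def)
        have "z \<in> right_verts d" using z by (simp add: right_verts_def)
        then show ?thesis using bip(2)[OF y(1) xr] bip(1)[of y z] y z x right by (meson rtrancl_trans)
      qed
    next
      case 3
      then show ?thesis using body x by simp
    qed
  qed
  have "sym ?R" by (auto simp: sym_def insert_commute)
  then have sym: "sym (?R\<^sup>*)" by (rule sym_rtrancl)
  show "connected_graph ?G"
    unfolding connected_graph_def
  proof (intro conjI ballI)
    show "verts ?G \<noteq> {}" using h by (auto simp: delete_verts_def)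
    fix x y assume "x \<in> verts ?G" "y \<in> verts ?G"
    then have "(x, h) \<in> ?R\<^sup>*" "(y, h) \<in> ?R\<^sup>*" using to_h by (auto simp: delete_verts_def)
    then show "(x, y) \<in> ?R\<^sup>*" using sym by (meson rtrancl_trans symD)
  qed
qed

section \<open>Persistence of the reflected solution\<close>

text \<open>Existence without uniqueness, so an open mapping theorem at one point of
  differentiability suffices: it is applied to \<open>(P, y) \<mapsto> (P, F (P, y))\<close>, whose
  image of a small ball contains \<open>(P, 0)\<close> for all \<open>P\<close> near
  \<open>P0\<close>.\<close>

lemma implicit_zero_exists:
  fixes F :: "'p::euclidean_space \<times> 'y::euclidean_space \<Rightarrow> 'y"
  assumes cont: "continuous_on UNIV F" and der: "(F has_derivative F') (at (P0, y0))"
    and zero: "F (P0, y0) = 0" and inj: "\<And>h. F' (0, h) = 0 \<Longrightarrow> h = 0" and "\<epsilon> > 0"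
  obtains \<delta> where "\<delta> > 0" "\<And>P. norm (P - P0) < \<delta> \<Longrightarrow> \<exists>y. norm (y - y0) < \<epsilon> \<and> F (P, y) = 0"
proof -
  interpret F': bounded_linear F' using der by (rule has_derivative_bounded_linear)
  have add: "F' (a, h) = F' (a, 0) + F' (0, h)" for a h
    using F'.add[of "(a, 0)" "(0, h)"] by simp
  define J where "J = (\<lambda>h. F' (0, h))"
  have linJ: "linear J"
    unfolding J_def
    by (rule linearI) (use F'.add[of "(0, _)" "(0, _)"] F'.scaleR[of _ "(0, _)"] in auto)
  have "inj J" using inj linJ by (simp add: J_def linear_injective_0)
  then obtain K where K: "linear K" "\<And>w. J (K w) = w"
    using linear_injective_isomorphism[OF linJ] by auto
  define G where "G = (\<lambda>x. (fst x, F x))"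
  define G' where "G' = (\<lambda>x. (fst x, F' x))"
  \<comment> \<open>A right inverse of the block triangular \<open>G'\<close>: the effect of the
    parameter is subtracted before the partial derivative \<open>J\<close> is inverted.\<close>
  define g' where "g' = (\<lambda>x. (fst x, K (snd x - F' (fst x, 0))))"
  have "(G has_derivative G') (at (P0, y0))"
    unfolding G_def G'_def by (intro has_derivative_Pair der derivative_intros)
  moreover have "bounded_linear g'"
    unfolding g'_def
    by (intro bounded_linear_Pair bounded_linear_fst
        bounded_linear_compose[OF linear_conv_bounded_linear[THEN iffD1, OF K(1)]]
        bounded_linear_sub bounded_linear_snd bounded_linear_compose[OF F'.bounded_linear_axioms]
        bounded_linear_zero)
  moreover have "G' \<circ> g' = id"
  proof
    fix x
    have "F' (fst x, K (snd x - F' (fst x, 0))) = F' (fst x, 0) + J (K (snd x - F' (fst x, 0)))"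
      unfolding J_def by (rule add)
    then show "(G' \<circ> g') x = id x" by (simp add: G'_def g'_def K(2))
  qed
  moreover have "continuous_on UNIV G"
    unfolding G_def by (intro continuous_intros cont)
  moreover have "(P0, y0) \<in> interior (ball (P0, y0) \<epsilon>)" using \<open>\<epsilon> > 0\<close> by simp
  ultimately have "G (P0, y0) \<in> interior (G ` ball (P0, y0) \<epsilon>)"
    by (intro sussmann_open_mapping[of UNIV]) auto
  then obtain \<delta> where \<delta>: "\<delta> > 0" "ball (P0, 0) \<delta> \<subseteq> G ` ball (P0, y0) \<epsilon>"
    using zero by (auto simp: mem_interior G_def)
  show thesis
  proof (rule that[OF \<delta>(1)])
    fix P assume "norm (P - P0) < \<delta>"
    then have "(P, 0) \<in> ball (P0, 0) \<delta>" by (simp add: dist_Pair_Pair dist_norm norm_minus_commute)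
    then obtain x where x: "x \<in> ball (P0, y0) \<epsilon>" "(P, 0) = G x" using \<delta>(2) by blast
    have "norm (snd x - y0) < \<epsilon>"
      using x(1) dist_snd_le[of "(P0, y0)" x] by (simp add: dist_norm norm_minus_commute)
    moreover have "F (P, snd x) = 0" using x(2) by (cases x) (simp add: G_def)
    ultimately show "\<exists>y. norm (y - y0) < \<epsilon> \<and> F (P, y) = 0" by blast
  qed
qed

lemma has_derivative_half_square:
  fixes A :: "'a::real_normed_vector \<Rightarrow> 'b::real_inner"
  assumes "bounded_linear A"
  shows "((\<lambda>x. (A x \<bullet> A x) / 2) has_derivative (\<lambda>h. A x0 \<bullet> A h)) (at x0)"
proof -
  have "(A has_derivative A) (at x0)" by (rule bounded_linear_imp_has_derivative[OF assms])
  then have "((\<lambda>x. A x \<bullet> A x) has_derivative (\<lambda>h. A x0 \<bullet> A h + A h \<bullet> A x0)) (at x0)"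
    by (intro has_derivative_inner)
  from has_derivative_mult_left[OF this, of "1/2"] show ?thesis by (simp add: inner_commute)
qed

text \<open>The norm is at most the sum of the component norms; the additional \<open>1\<close> in
  the factor yields the strict inequality.\<close>

lemma norm_vec_less:
  fixes x :: "('a::real_normed_vector) ^ 'm"
  assumes "\<And>c. norm (x $ c) < \<delta>"
  shows "norm x < (real CARD('m) + 1) * \<delta>"
proof -
  have "\<delta> > 0" using assms[of undefined] by (metis norm_ge_zero order_le_less_trans)
  have "norm x \<le> (\<Sum>c\<in>UNIV. norm (x $ c))"
    unfolding norm_vec_def by (rule L2_set_le_sum) simp
  also have "\<dots> \<le> (\<Sum>c\<in>(UNIV :: 'm set). \<delta>)"
    using assms by (intro sum_mono less_imp_le)
  also have "\<dots> < (real CARD('m) + 1) * \<delta>" using \<open>\<delta> > 0\<close> by (simp add: algebra_simps)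
  finally show ?thesis .
qed

text \<open>The lengths of the tight pairs form a square system for the nine free vertices.\<close>

lemma tight_lengths_persist:
  fixes z z' :: "nat \<Rightarrow> real ^ 'n"
  assumes d: "CARD('n) \<ge> 5" and pin: "pinned_rigid z" and body: "\<And>i. i \<ge> 9 \<Longrightarrow> z i = z' i"
    and len: "\<And>i j. (i, j) \<in> tight_pairs CARD('n) \<Longrightarrow> norm (z i - z j) = norm (z' i - z' j)"
    and "\<epsilon> > 0"
  obtains \<delta> where "\<delta> > 0"
    "\<And>p :: nat \<Rightarrow> real ^ 'n. (\<And>i. i < 2 * CARD('n) + 5 \<Longrightarrow> norm (p i - z' i) < \<delta>) \<Longrightarrow>
       \<exists>q. (\<forall>i\<ge>9. q i = p i) \<and> (\<forall>i<9. norm (q i - z i) < \<epsilon>) \<and>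
         (\<forall>(i, j)\<in>tight_pairs CARD('n). norm (q i - q j) = norm (p i - p j))"
proof -
  let ?d = "CARD('n)"
  obtain h :: "nat \<Rightarrow> 9" where h: "bij_betw h {..<9} UNIV" by (rule bij_betw_free_verts)
  \<comment> \<open>The type \<open>('n + 'n) + 5\<close> has exactly \<open>2 * d + 5\<close>
    elements, so placements of all vertices involved form a Euclidean space, as the implicit
    function argument needs.\<close>
  have "card {..<2 * ?d + 5} = card (UNIV :: (('n + 'n) + 5) set)" by simp
  then obtain \<psi> :: "nat \<Rightarrow> ('n + 'n) + 5" where \<psi>: "bij_betw \<psi> {..<2 * ?d + 5} UNIV"
    using finite_same_card_bij[of "{..<2 * ?d + 5}" "UNIV :: (('n + 'n) + 5) set"] by auto
  have "card (UNIV :: (9 \<times> 'n) set) = card (tight_pairs ?d)"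
    by (simp add: card_tight_pairs[OF d])
  then obtain e :: "9 \<times> 'n \<Rightarrow> nat \<times> nat" where e: "bij_betw e UNIV (tight_pairs ?d)"
    using finite_same_card_bij[of "UNIV :: (9 \<times> 'n) set" "tight_pairs ?d"] finite_tight_pairs by auto
  \<comment> \<open>\<open>\<beta>\<close> reads vertices of the given framework \<open>P\<close>;
    \<open>\<alpha>\<close> reads those of the sought one, with free vertices from \<open>y\<close>
    and anchors from \<open>P\<close>. A zero of \<open>F\<close> says that all tight lengths
    agree.\<close>
  define \<beta> where "\<beta> = (\<lambda>i (x :: (real ^ 'n ^ (('n + 'n) + 5)) \<times> (real ^ 'n ^ 9)). fst x $ \<psi> i)"
  define \<alpha> where "\<alpha> = (\<lambda>i (x :: (real ^ 'n ^ (('n + 'n) + 5)) \<times> (real ^ 'n ^ 9)).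
     if i < 9 then snd x $ h i else fst x $ \<psi> i)"
  have bl\<beta>: "bounded_linear (\<beta> i)" for i
    unfolding \<beta>_def by (intro bounded_linear_compose[OF bounded_linear_vec_nth] bounded_linear_fst)
  have bl\<alpha>: "bounded_linear (\<alpha> i)" for i
    unfolding \<alpha>_def
    by (cases "i < 9") (auto intro: bounded_linear_compose[OF bounded_linear_vec_nth]
        bounded_linear_fst bounded_linear_snd)
  define A where "A = (\<lambda>(i, j) x. \<alpha> i x - \<alpha> j x)"
  define B where "B = (\<lambda>(i, j) x. \<beta> i x - \<beta> j x)"
  have blA: "bounded_linear (A ij)" and blB: "bounded_linear (B ij)" for ij
    unfolding A_def B_def by (cases ij; simp add: bounded_linear_sub bl\<alpha> bl\<beta>)+
  define F :: "_ \<Rightarrow> real ^ 'n ^ 9" where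
    "F = (\<lambda>x. \<chi> c k. (A (e (c, k)) x \<bullet> A (e (c, k)) x) / 2 - (B (e (c, k)) x \<bullet> B (e (c, k)) x) / 2)"
  define P0 :: "real ^ 'n ^ (('n + 'n) + 5)" where
    "P0 = (\<chi> c. z' (inv_into {..<2 * ?d + 5} \<psi> c))"
  define y0 :: "real ^ 'n ^ 9" where "y0 = (\<chi> c. z (inv_into {..<9} h c))"
  define F' :: "_ \<Rightarrow> real ^ 'n ^ 9" where
    "F' = (\<lambda>x. \<chi> c k. A (e (c, k)) (P0, y0) \<bullet> A (e (c, k)) x - B (e (c, k)) (P0, y0) \<bullet> B (e (c, k)) x)"
  have inv\<psi>: "inv_into {..<2 * ?d + 5} \<psi> (\<psi> i) = i" if "i < 2 * ?d + 5" for i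
    using bij_betw_inv_into_left[OF \<psi>] that by simp
  have invh: "inv_into {..<9} h (h i) = i" if "i < 9" for i
    using bij_betw_inv_into_left[OF h] that by simp
  have A0: "A (i, j) (P0, y0) = z i - z j" and B0: "B (i, j) (P0, y0) = z' i - z' j"
    if "(i, j) \<in> tight_pairs ?d" for i j
    using tight_pairs_verts[OF d that] body
    by (auto simp: A_def B_def \<alpha>_def \<beta>_def P0_def y0_def inv\<psi> invh)
  have e_in: "e ck \<in> tight_pairs ?d" for ck using e by (auto simp: bij_betw_def)
  have e_surj: "\<exists>c k. ij = e (c, k)" if "ij \<in> tight_pairs ?d" for ij
    using e that unfolding bij_betw_def by (metis imageE surj_pair)
  have contF: "continuous_on UNIV F"
    unfolding F_def
    by (intro continuous_on_vec_lambda continuous_intros linear_continuous_on blA blB) auto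
  have derF: "(F has_derivative F') (at (P0, y0))"
  proof (subst has_derivative_componentwise_within, intro ballI)
    fix b :: "real ^ 'n ^ 9" assume "b \<in> Basis"
    then obtain c k where b: "b = axis c (axis k 1)" by (auto simp: Basis_vec_def)
    have nth: "v \<bullet> b = v $ c $ k" for v by (simp add: b inner_axis)
    show "((\<lambda>x. F x \<bullet> b) has_derivative (\<lambda>x. F' x \<bullet> b)) (at (P0, y0))"
      unfolding nth F_def F'_def
      by (simp, intro has_derivative_diff has_derivative_half_square blA blB)
  qed
  have zeroF: "F (P0, y0) = 0"
  proof -
    have "A ij (P0, y0) \<bullet> A ij (P0, y0) = B ij (P0, y0) \<bullet> B ij (P0, y0)" if "ij \<in> tight_pairs ?d" for ij
      using that len by (cases ij) (simp add: A0 B0 norm_eq)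
    then show ?thesis using e_in by (simp add: F_def vec_eq_iff)
  qed
  have injF: "y = 0" if "F' (0, y) = 0" for y
  proof -
    define u where "u = (\<lambda>i. if i < 9 then y $ h i else 0)"
    have "\<forall>i\<ge>9. u i = 0" by (simp add: u_def)
    moreover have "(z i - z j) \<bullet> (u i - u j) = 0" if ij: "(i, j) \<in> tight_pairs ?d" for i j
    proof -
      obtain c k where ck: "(i, j) = e (c, k)" using e_surj[OF ij] by blast
      have "A (i, j) (P0, y0) \<bullet> A (i, j) (0, y) - B (i, j) (P0, y0) \<bullet> B (i, j) (0, y) = 0"
        using \<open>F' (0, y) = 0\<close> unfolding ck by (simp add: F'_def vec_eq_iff)
      moreover have "A (i, j) (0, y) = u i - u j" "B (i, j) (0, y) = 0"
        by (simp_all add: A_def B_def \<alpha>_def \<beta>_def u_def)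
      ultimately show ?thesis using A0[OF ij] by simp
    qed
    ultimately have "u i = 0" for i using pin unfolding pinned_rigid_def by blast
    then have "y $ h i = 0" if "i < 9" for i using that unfolding u_def by metis
    then show "y = 0" using h by (auto simp: vec_eq_iff bij_betw_def) (metis UNIV_I imageE lessThan_iff)
  qed
  obtain \<delta> where \<delta>: "\<delta> > 0" "\<And>P. norm (P - P0) < \<delta> \<Longrightarrow> \<exists>y. norm (y - y0) < \<epsilon> \<and> F (P, y) = 0"
    using implicit_zero_exists[OF contF derF zeroF injF \<open>\<epsilon> > 0\<close>] by blast
  let ?M = "real CARD(('n + 'n) + 5) + 1"
  show thesis
  proof (rule that[of "\<delta> / ?M"])
    show "\<delta> / ?M > 0" using \<delta>(1) by (simp add: add_pos_nonneg)
    fix p :: "nat \<Rightarrow> real ^ 'n"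
    assume p: "\<And>i. i < 2 * ?d + 5 \<Longrightarrow> norm (p i - z' i) < \<delta> / ?M"
    define P :: "real ^ 'n ^ (('n + 'n) + 5)" where "P = (\<chi> c. p (inv_into {..<2 * ?d + 5} \<psi> c))"
    have "norm (P - P0) < ?M * (\<delta> / ?M)"
    proof (rule norm_vec_less)
      fix c
      have "inv_into {..<2 * ?d + 5} \<psi> c < 2 * ?d + 5"
        using bij_betw_inv_into[OF \<psi>] by (auto simp: bij_betw_def)
      then show "norm ((P - P0) $ c) < \<delta> / ?M" using p by (simp add: P_def P0_def)
    qed
    also have "?M * (\<delta> / ?M) = \<delta>" by (simp add: add_nonneg_eq_0_iff)
    finally obtain y where y: "norm (y - y0) < \<epsilon>" "F (P, y) = 0" using \<delta>(2) by blast
    define q where "q = (\<lambda>i. if i < 9 then y $ h i else p i)"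
    have "norm (q i - z i) < \<epsilon>" if "i < 9" for i
    proof -
      have "q i - z i = (y - y0) $ h i" using that by (simp add: q_def y0_def invh)
      then show ?thesis using order_le_less_trans[OF Finite_Cartesian_Product.norm_nth_le y(1)] by metis
    qed
    moreover have "norm (q i - q j) = norm (p i - p j)" if ij: "(i, j) \<in> tight_pairs ?d" for i j
    proof -
      obtain c k where ck: "(i, j) = e (c, k)" using e_surj[OF ij] by blast
      have "A (i, j) (P, y) \<bullet> A (i, j) (P, y) = B (i, j) (P, y) \<bullet> B (i, j) (P, y)"
        using y(2) unfolding ck by (simp add: F_def vec_eq_iff)
      moreover have "A (i, j) (P, y) = q i - q j" "B (i, j) (P, y) = p i - p j"
        using tight_pairs_verts[OF d ij] by (auto simp: A_def B_def \<alpha>_def \<beta>_def P_def q_def inv\<psi>)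
      ultimately show ?thesis by (simp add: norm_eq)
    qed
    moreover have "q i = p i" if "i \<ge> 9" for i using that by (simp add: q_def)
    ultimately show "\<exists>q. (\<forall>i\<ge>9. q i = p i) \<and> (\<forall>i<9. norm (q i - z i) < \<epsilon>) \<and>
         (\<forall>(i, j)\<in>tight_pairs ?d. norm (q i - q j) = norm (p i - p j))"
      by (intro exI[of _ q]) auto
  qed
qed

text \<open>An affine dependency of \<open>p\<close> on one side of a bipartite framework carries over to every
  equivalent \<open>q\<close>, because \<open>\<Sum>l. c l *\<^sub>R q l\<close> has constant inner product with the other side.\<close>

lemma dependency_forces_length:
  fixes p q :: "'a \<Rightarrow> real ^ 'n"
  assumes gp: "general_position V p" and X: "X \<subseteq> V" "card X = CARD('n) + 2"
    and Y: "affinely_indep Y q" "card Y = CARD('n) + 1"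
    and len: "\<And>l r. l \<in> X \<Longrightarrow> r \<in> Y \<Longrightarrow> norm (q l - q r) = norm (p l - p r)"
    and l0: "l0 \<in> X" and len0: "\<And>l. l \<in> X \<Longrightarrow> l \<noteq> l0 \<Longrightarrow> norm (q l - q r0) = norm (p l - p r0)"
  shows "norm (q l0 - q r0) = norm (p l0 - p r0)"
proof -
  have fin: "finite X" using X(2) by (metis card.infinite add_2_eq_Suc' nat.distinct(1))
  obtain c where c: "sum c X = 0" "(\<Sum>l\<in>X. c l *\<^sub>R p l) = 0" "\<And>l. l \<in> X \<Longrightarrow> c l \<noteq> 0"
    using affine_dependency[OF gp X] by blast
  define w where "w = (\<Sum>l\<in>X. c l *\<^sub>R q l)"
  define s where "s = (\<Sum>l\<in>X. c l * (q l \<bullet> q l - p l \<bullet> p l))"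
  let ?D = "\<lambda>l r. (q l - q r) \<bullet> (q l - q r) - (p l - p r) \<bullet> (p l - p r)"
  \<comment> \<open>After expansion, \<open>sum c X = 0\<close> removes the terms in
    \<open>r\<close> alone and the dependency of \<open>p\<close> removes the mixed terms with
    \<open>p r\<close>.\<close>
  have sum: "(\<Sum>l\<in>X. c l * ?D l r) = s - 2 * (q r \<bullet> w)" for r
  proof -
    have "c l * ?D l r = c l * (q l \<bullet> q l - p l \<bullet> p l) - 2 * (q r \<bullet> (c l *\<^sub>R q l))
      + c l * (q r \<bullet> q r - p r \<bullet> p r) + 2 * (p r \<bullet> (c l *\<^sub>R p l))" for l
      by (simp add: inner_diff_left inner_diff_right inner_commute algebra_simps)
    then have "(\<Sum>l\<in>X. c l * ?D l r) = s - 2 * (q r \<bullet> w) + sum c X * (q r \<bullet> q r - p r \<bullet> p r)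
       + 2 * (p r \<bullet> (\<Sum>l\<in>X. c l *\<^sub>R p l))"
      by (simp only: sum.distrib sum_subtractf s_def w_def inner_sum_right sum_distrib_left sum_distrib_right)
    then show ?thesis using c by simp
  qed
  have "?D l r = 0" if "l \<in> X" "r \<in> Y" for l r
    using len[OF that] by (simp add: norm_eq)
  then have *: "s = 2 * (q r \<bullet> w)" if "r \<in> Y" for r
    using sum[of r] that by simp
  then have "w = 0" by (intro orthogonal_to_frame[OF Y]) (metis mult_left_cancel zero_neq_numeral)
  moreover obtain r where "r \<in> Y" using Y(2) by fastforce
  ultimately have "s = 0" using * by simp
  have "?D l r0 = 0" if "l \<in> X" "l \<noteq> l0" for l
    using len0[OF that] by (simp add: norm_eq)
  then have "(\<Sum>l\<in>X. c l * ?D l r0) = c l0 * ?D l0 r0"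
    using fin l0 by (simp add: sum.remove[of X l0])
  then have "?D l0 r0 = 0" using sum[of r0] \<open>s = 0\<close> \<open>w = 0\<close> c(3)[OF l0] by simp
  then show ?thesis by (simp add: norm_eq)
qed

section \<open>The reflected configuration and failure of global rigidity\<close>

context coordinates
begin

definition reflect :: "real ^ 'n \<Rightarrow> real ^ 'n" where
  "reflect x = (\<chi> c. if c = \<kappa> 2 then - x $ c else x $ c)"

lemma norm_reflect_diff: "norm (reflect x - reflect y) = norm (x - y)"
proof -
  have "\<bar>reflect x $ c - reflect y $ c\<bar> = \<bar>x $ c - y $ c\<bar>" for c
    by (simp add: reflect_def abs_minus_commute)
  then show ?thesis by (simp add: norm_vec_def)
qed

lemma reflect_anchor:
  assumes "9 \<le> i" "i < 2 * CARD('n) + 5"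
  shows "reflect (base i) = base i"
  using assms dim kappa_inj[of _ 2]
  by (auto simp: vec_eq_coords reflect_def base_nth base_coord_def)

text \<open>Three free right vertices complete the \<open>d - 2\<close> right anchors to a frame of
  \<open>d + 1\<close> points, the set \<open>Y\<close> for \<open>dependency_forces_length\<close>.
  The right vertices 7 and 8 left over are the ends of the dropped edges.\<close>

lemma affinely_indep_base:
  "affinely_indep ({4, 5, 6} \<union> {CARD('n) + 7..<2 * CARD('n) + 5}) base"
  unfolding affinely_indep_def
proof (intro allI impI, elim conjE)
  let ?d = "CARD('n)"
  let ?A = "{?d + 7..<2 * ?d + 5}"
  fix c :: "nat \<Rightarrow> real"
  assume c0: "sum c ({4, 5, 6} \<union> ?A) = 0"
    and c1: "(\<Sum>i\<in>{4, 5, 6} \<union> ?A. c i *\<^sub>R base i) = 0"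
  have split: "sum f ({4, 5, 6} \<union> ?A) = f 4 + f 5 + f 6 + (\<Sum>s\<in>{2..<?d}. f (s + (?d + 5)))"
    for f :: "nat \<Rightarrow> 'z::comm_monoid_add"
  proof -
    have "?A = {2 + (?d + 5)..<?d + (?d + 5)}" by auto
    then have "sum f ?A = (\<Sum>s\<in>{2..<?d}. f (s + (?d + 5)))"
      by (simp only: sum.shift_bounds_nat_ivl)
    moreover have "{4, 5, 6} \<inter> ?A = {}" by auto
    then have "sum f ({4, 5, 6} \<union> ?A) = sum f {4, 5, 6} + sum f ?A"
      by (intro sum.union_disjoint) auto
    ultimately show ?thesis by (simp add: add.assoc)
  qed
  define a where "a = (\<lambda>s. c (s + (?d + 5)))"
  have coord: "c 4 * base_coord ?d 4 k + c 5 * base_coord ?d 5 k + c 6 * base_coord ?d 6 k +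
     (\<Sum>s\<in>{2..<?d}. a s * base_coord ?d (s + (?d + 5)) k) = 0" if "k < ?d" for k
  proof -
    have "(\<Sum>i\<in>{4, 5, 6} \<union> ?A. c i *\<^sub>R base i) $ \<kappa> k = 0" unfolding c1 by simp
    then show ?thesis unfolding split by (simp add: base_nth[OF that] a_def)
  qed
  have bc: "base_coord ?d (s + (?d + 5)) k =
     (if s = 2 then 0 else if k = s then 1 else if s = 3 \<and> k = 0 \<or> s = 4 \<and> k = 1 then - 1 else 0)"
    if "2 \<le> s" "s < ?d" for s k
    using that by (auto simp: base_coord_def)
  have sum_bc: "(\<Sum>s\<in>{2..<?d}. a s * base_coord ?d (s + (?d + 5)) k) =
     (if k = 0 then - a 3 else if k = 1 then - a 4 else if k = 2 then 0 else a k)" if "k < ?d" for k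
  proof -
    \<comment> \<open>The only anchor index that can contribute to coordinate \<open>k\<close>; for
      \<open>k = 2\<close> it is the anchor at the origin, which contributes zero.\<close>
    let ?s = "if k = 0 then 3 else if k = 1 then 4 else k"
    have "(\<Sum>s\<in>{2..<?d}. a s * base_coord ?d (s + (?d + 5)) k) =
      (\<Sum>s\<in>{?s}. a s * base_coord ?d (s + (?d + 5)) k)"
      by (rule sum.mono_neutral_right) (use that dim bc in \<open>auto split: if_splits\<close>)
    then show ?thesis using that dim bc[of ?s k] by (auto split: if_splits)
  qed
  have k: "c 4 * base_coord ?d 4 k + c 5 * base_coord ?d 5 k + c 6 * base_coord ?d 6 k +
     (if k = 0 then - a 3 else if k = 1 then - a 4 else if k = 2 then 0 else a k) = 0" if "k < ?d" for k
    using coord[OF that] sum_bc[OF that] by simp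
  have "c 5 + c 6 - a 3 = 0" "c 4 - a 4 = 0" "c 6 = 0" "c 4 - c 5 - c 6 + a 3 = 0" "- c 4 + c 5 + a 4 = 0"
    using k[of 0] k[of 1] k[of 2] k[of 3] k[of 4] dim by (simp_all add: base_coord_def)
  then have z: "c 4 = 0" "c 5 = 0" "c 6 = 0" "a 3 = 0" "a 4 = 0" by linarith+
  have a5: "a s = 0" if "5 \<le> s" "s < ?d" for s
    using k[OF that(2)] that(1) z by simp
  have a3: "a s = 0" if "3 \<le> s" "s < ?d" for s
    using z a5[of s] that by (cases "s = 3"; cases "s = 4") auto
  have "(\<Sum>s\<in>{2..<?d}. a s) = (\<Sum>s\<in>{2}. a s)"
    by (rule sum.mono_neutral_right) (use a3 dim in auto)
  moreover have "(\<Sum>s\<in>{2..<?d}. a s) = 0"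
    using c0 z unfolding split by (simp add: a_def)
  ultimately have "a 2 = 0" by simp
  have all: "a s = 0" if "2 \<le> s" "s < ?d" for s
    using a3 \<open>a 2 = 0\<close> that by (cases "s = 2") auto
  have "c i = 0" if "i \<in> ?A" for i
  proof -
    have "2 \<le> i - (?d + 5)" "i - (?d + 5) < ?d" using that by auto
    then have "a (i - (?d + 5)) = 0" by (rule all)
    then show ?thesis using that by (simp add: a_def)
  qed
  then show "\<forall>i\<in>{4, 5, 6} \<union> ?A. c i = 0" using z by auto
qed

text \<open>The generic \<open>p\<close> is taken near the mirror image \<open>mir\<close>, and its
  partner \<open>q\<close> is found near \<open>base\<close>: the implicit function argument needs
  nonsingularity at the second solution, which \<open>pinned_rigid_base\<close> supplies.\<close>

lemma generic_not_globally_rigid: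
  assumes n: "n \<ge> 2 * CARD('n) + 6"
  obtains p :: "nat \<Rightarrow> real ^ 'n" where
    "generic (body_bipartite_graph CARD('n) n) p" "\<not> globally_rigid (body_bipartite_graph CARD('n) n) p"
proof -
  let ?d = "CARD('n)" and ?G = "body_bipartite_graph CARD('n) n"
  let ?Y = "{4, 5, 6} \<union> {?d + 7..<2 * ?d + 5}"
  have cY: "card ?Y = ?d + 1" using dim by (subst card_Un_disjoint) auto
  have Ysub: "?Y \<subseteq> {..<2 * ?d + 5}" using dim by auto
  obtain \<epsilon>1 where \<epsilon>1: "\<epsilon>1 > 0"
    "\<And>q. (\<And>i. i \<in> {..<2 * ?d + 5} \<Longrightarrow> norm (q i - base i) < \<epsilon>1) \<Longrightarrow> affinely_indep ?Y q"
    using zariski_open_near[OF zariski_open_affinely_indep[OF cY Ysub] affinely_indep_base] by blast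
  \<comment> \<open>\<open>\<epsilon>1\<close> keeps the frame \<open>?Y\<close> affinely
    independent at \<open>q\<close>; the bound \<open>1/2\<close> serves the noncongruence estimate
    at the end.\<close>
  define \<epsilon> where "\<epsilon> = min \<epsilon>1 (1/2)"
  define mir where "mir = (\<lambda>i. if i < 9 then reflect (base i) else base i)"
  have mir: "mir i = reflect (base i)" if "i < 2 * ?d + 5" for i
    using that reflect_anchor[of i] by (simp add: mir_def)
  have "\<epsilon> > 0" using \<epsilon>1(1) by (simp add: \<epsilon>_def)
  have len0: "norm (base i - base j) = norm (mir i - mir j)" if "(i, j) \<in> tight_pairs ?d" for i j
    using tight_pairs_verts[OF dim that] by (simp add: mir norm_reflect_diff)
  have body: "base i = mir i" if "i \<ge> 9" for i using that by (simp add: mir_def)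
  obtain \<delta>1 where \<delta>1: "\<delta>1 > 0"
    "\<And>p :: nat \<Rightarrow> real ^ 'n. (\<And>i. i < 2 * ?d + 5 \<Longrightarrow> norm (p i - mir i) < \<delta>1) \<Longrightarrow>
       \<exists>q. (\<forall>i\<ge>9. q i = p i) \<and> (\<forall>i<9. norm (q i - base i) < \<epsilon>) \<and>
         (\<forall>(i, j)\<in>tight_pairs ?d. norm (q i - q j) = norm (p i - p j))"
  proof (rule tight_lengths_persist[OF dim pinned_rigid_base body len0 \<open>\<epsilon> > 0\<close>])
    fix \<delta> assume "\<delta> > 0" and *: "\<And>p :: nat \<Rightarrow> real ^ 'n.
      (\<And>i. i < 2 * ?d + 5 \<Longrightarrow> norm (p i - mir i) < \<delta>) \<Longrightarrow>
       \<exists>q. (\<forall>i\<ge>9. q i = p i) \<and> (\<forall>i<9. norm (q i - base i) < \<epsilon>) \<and>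
         (\<forall>(i, j)\<in>tight_pairs ?d. norm (q i - q j) = norm (p i - p j))"
    show thesis by (rule that[OF \<open>\<delta> > 0\<close> *])
  qed
  define \<delta> where "\<delta> = min \<delta>1 \<epsilon>"
  have "\<delta> > 0" using \<delta>1(1) \<open>\<epsilon> > 0\<close> by (simp add: \<delta>_def)
  then have \<delta>d: "\<delta> / (real ?d + 1) > 0" by (simp add: add_pos_nonneg)
  define x0 where "x0 = (\<lambda>(i, k). mir i $ k)"
  have "finite ({..<n} \<times> (UNIV :: 'n set))" by simp
  then obtain x where x: "alg_independent_over_rat ({..<n} \<times> (UNIV :: 'n set)) x"
    "\<And>ik. ik \<in> {..<n} \<times> (UNIV :: 'n set) \<Longrightarrow> \<bar>x ik - x0 ik\<bar> < \<delta> / (real ?d + 1)"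
    using alg_independent_dense[OF _ \<delta>d, of "{..<n} \<times> (UNIV :: 'n set)" x0] by blast
  define p :: "nat \<Rightarrow> real ^ 'n" where "p = (\<lambda>i. \<chi> k. x (i, k))"
  have alg: "alg_independent_over_rat ({..<n} \<times> UNIV) (\<lambda>(i, k). p i $ k)"
    using x(1) by (simp add: p_def case_prod_beta)
  then have gen: "generic ?G p" by (simp add: generic_def)
  have gp: "general_position {..<n} p" by (rule generic_general_position[OF alg])
  have p: "norm (p i - mir i) < \<delta>" if "i < n" for i
  proof -
    have "norm ((p i - mir i) $ k) < \<delta> / (real ?d + 1)" for k
      using x(2)[of "(i, k)"] that by (simp add: p_def x0_def)
    then have "norm (p i - mir i) < (real ?d + 1) * (\<delta> / (real ?d + 1))"
      by (rule norm_vec_less)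
    then show ?thesis by (simp add: add_nonneg_eq_0_iff)
  qed
  have "norm (p i - mir i) < \<delta>1" if "i < 2 * ?d + 5" for i
    using p[of i] that n by (simp add: \<delta>_def)
  then obtain q where q_body: "\<And>i. i \<ge> 9 \<Longrightarrow> q i = p i" and q_near: "\<And>i. i < 9 \<Longrightarrow> norm (q i - base i) < \<epsilon>"
    and q_tight: "\<And>i j. (i, j) \<in> tight_pairs ?d \<Longrightarrow> norm (q i - q j) = norm (p i - p j)"
    using \<delta>1(2)[of p] by blast
  have q_near': "norm (q i - base i) < \<epsilon>" if "i < n" for i
    using q_near[of i] q_body[of i] p[OF that] by (cases "i < 9") (auto simp: mir_def \<delta>_def)
  have Yq: "affinely_indep ?Y q"
    using q_near' n by (intro \<epsilon>1(2)) (simp add: \<epsilon>_def)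
  have tight: "norm (q l - q r) = norm (p l - p r)"
    if l: "l \<in> left_verts ?d" and r: "r \<in> right_verts ?d" and ne: "l \<noteq> 3 \<or> r \<notin> {7, 8}" for l r
  proof -
    \<comment> \<open>\<open>tight_pairs\<close> lists the free vertex in front, hence the two
      orientations; two anchors keep their distance because \<open>q\<close> agrees with
      \<open>p\<close> on the body.\<close>
    have "(l, r) \<in> tight_pairs ?d \<or> (r, l) \<in> tight_pairs ?d \<or> l \<ge> 9 \<and> r \<ge> 9"
      using l r ne by (auto simp: tight_pairs_def left_verts_def right_verts_def)
    then show ?thesis
      using q_tight[of l r] q_tight[of r l] q_body[of l] q_body[of r]
      by (auto simp: norm_minus_commute)
  qed
  \<comment> \<open>All lengths from the left side to \<open>?Y\<close> are known, and
    \<open>r\<close> lacks only its length to vertex 3, which the dependency of the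
    \<open>d + 2\<close> left vertices determines.\<close>
  have missing: "norm (q 3 - q r) = norm (p 3 - p r)" if "r \<in> {7, 8}" for r
  proof (rule dependency_forces_length[OF gp _ card_left_verts[OF dim] Yq cY])
    show "left_verts ?d \<subseteq> {..<n}" using left_right_verts_subset(1)[of ?d n] n dim by simp
    show "3 \<in> left_verts ?d" by (simp add: left_verts_def)
    fix l assume l: "l \<in> left_verts ?d"
    show "norm (q l - q r') = norm (p l - p r')" if "r' \<in> ?Y" for r'
      using l that dim by (intro tight) (auto simp: right_verts_def)
    show "norm (q l - q r) = norm (p l - p r)" if "l \<noteq> 3"
      using l that \<open>r \<in> {7, 8}\<close> by (intro tight) (auto simp: right_verts_def)
  qed
  have bip: "norm (q l - q r) = norm (p l - p r)" if "l \<in> left_verts ?d" "r \<in> right_verts ?d" for l r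
    using tight[OF that] missing[of r] by (cases "l = 3") auto
  have len: "norm (q i - q j) = norm (p i - p j)" if "{i, j} \<in> edges ?G" for i j
    using that
  proof (cases rule: body_bipartite_edgesE)
    case (1 k l)
    then show ?thesis using bip by (auto simp: doubleton_eq_iff norm_minus_commute)
  next
    case (2 k l)
    then show ?thesis using q_body by (auto simp: doubleton_eq_iff)
  qed
  have "edge_map ?G p = edge_map ?G q"
    using len by (auto simp: edge_map_def fun_eq_iff)
  \<comment> \<open>Vertex \<open>2 * d + 5\<close> is the body vertex that \<open>base\<close>
    places off the mirror, available since \<open>n >= 2 * d + 6\<close>. It coincides with vertex 2
    in \<open>base\<close> but is at distance 2 from it in \<open>mir\<close>, so errors below
    \<open>1/2\<close> keep the lengths on different sides of 1.\<close>
  moreover have "norm (p 2 - p (2 * ?d + 5)) \<noteq> norm (q 2 - q (2 * ?d + 5))"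
  proof -
    let ?e = "2 * ?d + 5"
    have b: "base 2 = axis (\<kappa> 2) 1" "base ?e = axis (\<kappa> 2) 1"
      using dim kappa_inj[of _ 2] by (auto simp: vec_eq_coords base_nth base_coord_def axis_def nth_Cons')
    have r: "mir 2 = - axis (\<kappa> 2) 1" "mir ?e = axis (\<kappa> 2) 1"
      using dim by (auto simp: mir_def b reflect_def vec_eq_iff axis_def)
    have q2: "norm (q 2 - axis (\<kappa> 2) 1) < 1/2" "norm (q ?e - axis (\<kappa> 2) 1) < 1/2"
      using q_near'[of 2] q_near'[of ?e] n by (simp_all add: b \<epsilon>_def)
    have p2: "norm (p 2 + axis (\<kappa> 2) 1) < 1/2" "norm (p ?e - axis (\<kappa> 2) 1) < 1/2"
      using p[of 2] p[of ?e] n by (simp_all add: r \<delta>_def \<epsilon>_def)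
    have "norm (q 2 - q ?e) < 1"
      using q2 norm_triangle_ineq4[of "q 2 - axis (\<kappa> 2) 1" "q ?e - axis (\<kappa> 2) 1"] by simp
    moreover have "norm (2 *\<^sub>R axis (\<kappa> 2) (1::real) :: real ^ 'n) = 2" by (simp add: norm_eq_sqrt_inner inner_axis_axis)
    then have "norm (p 2 - p ?e) > 1"
    proof -
      have "2 *\<^sub>R axis (\<kappa> 2) 1 = ((p 2 + axis (\<kappa> 2) 1) - (p ?e - axis (\<kappa> 2) 1)) - (p 2 - p ?e)"
        by (simp add: scaleR_2)
      then have "2 \<le> norm ((p 2 + axis (\<kappa> 2) 1) - (p ?e - axis (\<kappa> 2) 1)) + norm (p 2 - p ?e)"
        using norm_triangle_ineq4 \<open>norm (2 *\<^sub>R axis (\<kappa> 2) (1::real) :: real ^ 'n) = 2\<close> by metis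
      then show ?thesis
        using p2 norm_triangle_ineq4[of "p 2 + axis (\<kappa> 2) 1" "p ?e - axis (\<kappa> 2) 1"] by linarith
    qed
    ultimately show ?thesis by simp
  qed
  moreover have "2 \<in> verts ?G" "2 * ?d + 5 \<in> verts ?G" using n by auto
  ultimately have "\<not> globally_rigid ?G p" unfolding globally_rigid_def by blast
  with gen show thesis by (rule that)
qed

lemma generically_partially_rigid_body_bipartite:
  assumes n: "n \<ge> 2 * CARD('n) + 6"
  shows "generically_partially_rigid TYPE('n) (body_bipartite_graph CARD('n) n)"
  unfolding generically_partially_rigid_def
proof (intro conjI)
  let ?d = "CARD('n)" and ?G = "body_bipartite_graph CARD('n) n"
  show "vertex_connected (?d + 1) ?G"
    using n by (intro vertex_connected_body_bipartite dim) simp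
  show "\<not> generically_globally_rigid TYPE('n) ?G"
    using generic_not_globally_rigid[OF n] by (auto simp: generically_globally_rigid_def)
  show "generically_redundantly_rigid TYPE('n) ?G"
    unfolding generically_redundantly_rigid_def redundantly_rigid_def
  proof (intro allI impI ballI)
    fix p :: "nat \<Rightarrow> real ^ 'n" and e assume "generic ?G p" and e: "e \<in> edges ?G"
    then have alg: "alg_independent_over_rat ({..<n} \<times> UNIV) (\<lambda>(i, k). p i $ k)"
      by (simp add: generic_def)
    have gp: "general_position {..<n} p" by (rule generic_general_position[OF alg])
    have V: "{..<2 * ?d + 5} \<subseteq> {..<n}" using n by auto
    have pin: "pinned_rigid p"
      by (rule zariski_open_generic[OF zariski_open_pinned_rigid[OF dim V] pinned_rigid_base alg])
    \<comment> \<open>General position and pinned rigidity both persist near \<open>p\<close>,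
      although nearby frameworks need not be generic; this supplies the neighbourhood that local
      rigidity requires.\<close>
    obtain \<epsilon>1 where \<epsilon>1: "\<epsilon>1 > 0" "\<And>m. (\<And>i. i \<in> {..<n} \<Longrightarrow> norm (m i - p i) < \<epsilon>1) \<Longrightarrow> general_position {..<n} m"
      using general_position_near[OF _ gp] by auto
    obtain \<epsilon>2 where \<epsilon>2: "\<epsilon>2 > 0" "\<And>m. (\<And>i. i \<in> {..<n} \<Longrightarrow> norm (m i - p i) < \<epsilon>2) \<Longrightarrow> pinned_rigid m"
      using zariski_open_near[OF zariski_open_pinned_rigid[OF dim V] pin] by blast
    show "locally_rigid (delete_edge ?G e) p"
    proof (rule locally_rigid_if_near_infinitesimally_rigid[where X = "{..<?d + 1}" and \<epsilon> = "min \<epsilon>1 \<epsilon>2"])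
      show "affinely_indep {..<?d + 1} p"
        using gp[unfolded general_position_def, rule_format, of "{..<?d + 1}"] n by (simp add: subset_iff)
      fix e' assume "e' \<in> edges (delete_edge ?G e)"
      then show "e' \<subseteq> verts (delete_edge ?G e)"
        using finite_simple_body_bipartite[OF dim, of n] n
        by (auto simp: finite_simple_graph_def delete_edge_def)
    next
      fix m :: "nat \<Rightarrow> real ^ 'n"
      assume m: "\<And>i. i \<in> verts (delete_edge ?G e) \<Longrightarrow> norm (m i - p i) < min \<epsilon>1 \<epsilon>2"
      then have "general_position {..<n} m" "pinned_rigid m"
        by (auto intro!: \<epsilon>1(2) \<epsilon>2(2) simp: delete_edge_def)
      then show "infinitesimally_rigid (delete_edge ?G e) m"
        by (rule infinitesimally_rigid_delete_edge[OF dim n])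
    qed (use n \<epsilon>1(1) \<epsilon>2(1) in \<open>auto simp: delete_edge_def\<close>)
  qed
qed

end

lemma graph_iso_card_verts:
  assumes "graph_iso G H"
  shows "card (verts G) = card (verts H)"
  using assms bij_betw_same_card by (auto simp: graph_iso_def)

theorem mainTheorem3:
  assumes "CARD('n::finite) \<ge> 5"
  shows "\<exists>\<G> :: nat graph set. infinite \<G> \<and>
    (\<forall>G\<in>\<G>. finite_simple_graph G \<and> generically_partially_rigid TYPE('n) G) \<and>
    (\<forall>G\<in>\<G>. \<forall>H\<in>\<G>. G \<noteq> H \<longrightarrow> \<not> graph_iso G H)"
proof -
  let ?d = "CARD('n)"
  have "card {..<?d} = card (UNIV :: 'n set)" by simp
  then obtain \<kappa> :: "nat \<Rightarrow> 'n" where "bij_betw \<kappa> {..<?d} UNIV"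
    using finite_same_card_bij[of "{..<?d}" "UNIV :: 'n set"] by auto
  then interpret coordinates \<kappa> using assms by unfold_locales
  let ?GG = "body_bipartite_graph ?d ` {2 * ?d + 6..}"
  have inj: "inj_on (body_bipartite_graph ?d) {2 * ?d + 6..}"
    by (rule inj_onI) (metis card_lessThan verts_body_bipartite)
  show ?thesis
  proof (intro exI[of _ ?GG] conjI ballI impI)
    show "infinite ?GG" using finite_imageD[OF _ inj] infinite_Ici by blast
    fix G assume "G \<in> ?GG"
    then obtain n where n: "n \<ge> 2 * ?d + 6" "G = body_bipartite_graph ?d n" by auto
    then show "finite_simple_graph G" "generically_partially_rigid TYPE('n) G"
      using finite_simple_body_bipartite[OF assms, of n] generically_partially_rigid_body_bipartite[OF n(1)]
      by auto
    fix H assume "H \<in> ?GG" "G \<noteq> H"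
    then obtain n' where n': "H = body_bipartite_graph ?d n'" by auto
    with n \<open>G \<noteq> H\<close> have "card (verts G) \<noteq> card (verts H)" by auto
    then show "\<not> graph_iso G H" using graph_iso_card_verts by blast
  qed
qed

end
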